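(* Let $\ell\ge 1$ and $n\ge 2\ell+1$ be integers with $(n,\ell)\ne(5,2)$. Then the $(n-\ell)$-deck of an $n$-vertex graph determines whether the graph is a tree. That is, if $G$ and $G'$ are two $n$-vertex graphs having the same $(n-\ell)$-deck, then $G$ is a tree if and only if $G'$ is a tree.
   Context: All graphs are finite and simple. The $k$-deck of a graph is the multiset of (isomorphism classes of) its $k$-vertex induced subgraphs, one for each $k$-element subset of the vertex set. Thus the $(n-\ell)$-deck of an $n$-vertex graph is the multiset of induced subgraphs obtained by deleting $\ell$ vertices. *)

theory Defs
  imports "HOL-Library.Multiset" "Graph_Theory.Graph_Theory"
begin

text \<open>
  Finite simple graphs are the instances of the locale \<^locale>\<open>graph\<close>: finite, symmetric,
  loop-free digraphs without parallel arcs. An undirected edge is thus a pair of opposite arcs.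
\<close>

text \<open>
  Isomorphism classes must live in a single type for the decks of graphs with different vertex
  and arc types to be comparable. Every finite graph is isomorphic to one on natural numbers, so
  a class is represented by the set of its members with vertices in \<^typ>\<open>nat\<close>; the lemma
  \<open>iso_class_eq_iff\<close> below confirms that this identifies exactly the isomorphic graphs.
\<close>

definition iso_class :: "('a, 'b) pre_digraph \<Rightarrow> nat pair_pre_digraph set" where
  "iso_class H = {K. pair_graph K \<and> digraph_iso H (with_proj K)}"

definition deck :: "nat \<Rightarrow> ('a, 'b) pre_digraph \<Rightarrow> nat pair_pre_digraph set multiset" where
  "deck k G = image_mset (\<lambda>S. iso_class (G \<restriction> S)) (mset_set {S. S \<subseteq> verts G \<and> card S = k})"

text \<open>
  The constants \<^const>\<open>forest\<close> and \<^const>\<open>tree\<close> of the library are meant for digraphs: there the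
  closed walk along an arc and its opposite counts as a cycle, so a symmetric digraph with an arc
  is never a tree. A cycle of a simple graph has at least three edges.
\<close>

definition graph_cycle :: "('a, 'b) pre_digraph \<Rightarrow> 'b list \<Rightarrow> bool" where
  "graph_cycle G p \<longleftrightarrow> pre_digraph.cycle G p \<and> 3 \<le> length p"

definition is_tree :: "('a, 'b) pre_digraph \<Rightarrow> bool" where
  "is_tree G \<longleftrightarrow> connected G \<and> \<not> (\<exists>p. graph_cycle G p)"

lemma iso_class_nonempty:
  assumes "graph H"
  shows "iso_class H \<noteq> {}"
proof -
  interpret graph H by fact
  obtain f :: "'a \<Rightarrow> nat" where f: "inj_on f (verts H)"
    using finite_imp_inj_to_nat_seg[OF finite_verts] by blast
  let ?g = "\<lambda>a. (f (tail H a), f (head H a))"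
  let ?K = "\<lparr>pverts = f ` verts H, parcs = ?g ` arcs H\<rparr>"
  let ?h = "\<lparr>iso_verts = f, iso_arcs = ?g, iso_head = snd, iso_tail = fst\<rparr>"
  have "inj_on ?g (arcs H)"
  proof (rule inj_onI)
    fix a b assume ab: "a \<in> arcs H" "b \<in> arcs H" "?g a = ?g b"
    then have "tail H a = tail H b" "head H a = head H b"
      using f by (auto dest: inj_onD)
    then show "a = b"
      using ab no_multi_arcs by (auto simp: arc_to_ends_def)
  qed
  then have "pre_digraph.digraph_isomorphism H ?h"
    using f by (auto simp: pre_digraph.digraph_isomorphism_def wf_digraph)
  moreover have "with_proj ?K = app_iso ?h H"
    by (simp add: with_proj_def app_iso_def)
  ultimately have "digraph_iso H (with_proj ?K)"
    unfolding digraph_iso_def by blast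
  moreover have "pair_graph ?K"
  proof
    show "symmetric (with_proj ?K)"
      using sym_arcs unfolding symmetric_conv by (fastforce simp: with_proj_def)
  qed (use no_loops in \<open>auto simp: inj_on_eq_iff[OF f]\<close>)
  ultimately show ?thesis by (auto simp: iso_class_def)
qed

lemma iso_class_eq_iff:
  assumes "graph H1" "graph H2"
  shows "iso_class H1 = iso_class H2 \<longleftrightarrow> digraph_iso H1 H2"
proof
  interpret H1: graph H1 by fact
  interpret H2: graph H2 by fact
  assume eq: "iso_class H1 = iso_class H2"
  obtain K where "K \<in> iso_class H1"
    using iso_class_nonempty[OF assms(1)] by blast
  with eq have "digraph_iso H1 (with_proj K)" "digraph_iso H2 (with_proj K)"
    by (auto simp: iso_class_def)
  then show "digraph_iso H1 H2"
    by (metis digraph_iso_swap[OF H2.wf_digraph] digraph_iso_trans)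
next
  interpret H1: graph H1 by fact
  assume 12: "digraph_iso H1 H2"
  then have 21: "digraph_iso H2 H1"
    by (rule digraph_iso_swap[OF H1.wf_digraph])
  show "iso_class H1 = iso_class H2"
    by (auto simp: iso_class_def intro: digraph_iso_trans[OF 12] digraph_iso_trans[OF 21])
qed

end

theory Submission
  imports Defs
begin

text \<open>
  Put \<open>k = n - l\<close>, so that \<open>n \<le> 2 * k - 1\<close>. The \<open>k\<close>-deck determines every isomorphism-invariant count
  over vertex sets of size at most \<open>k\<close>. Let \<open>G\<close> be a tree and suppose that \<open>G'\<close> has the same deck but is
  not a tree. Then \<open>G'\<close> has \<open>n - 1\<close> edges, all its cycles have more than \<open>k\<close> vertices, and it has a
  component \<open>T\<close> that is a tree; let \<open>t\<close> be the order of \<open>T\<close> and \<open>M\<close> the set of the other vertices, which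
  spans \<open>card M\<close> edges.

  For a connected \<open>t\<close>-set \<open>Q\<close> with \<open>b\<close> outer neighbours, the number of sets \<open>Z\<close> with
  \<open>Q \<subseteq> Z \<subseteq> N[Q]\<close> and \<open>card Z = t + j\<close> is \<open>b choose j\<close>. So as long as \<open>b \<le> k - t\<close> for all \<open>Q\<close>, the deck
  determines the number of \<open>Q\<close> with \<open>b = 0\<close>, which is 0 in \<open>G\<close> and positive in \<open>G'\<close>.

  If some \<open>Q\<close> in \<open>G'\<close> has \<open>b \<ge> k - t\<close>, choose \<open>Y\<close> with \<open>Q \<subseteq> Y \<subseteq> N[Q]\<close> and \<open>card Y = k\<close>. Counting edges, a
  path through \<open>M - Y\<close> closes up via \<open>Q\<close> to a cycle with at most \<open>n - k + 2\<close> vertices. This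
  forces \<open>n = 2 * k - 1\<close> and \<open>G'\<close> to consist of a \<open>(k + 1)\<close>-cycle with pendant vertices and a path \<open>T\<close>. Then
  the total excess of the degrees over 2 is at most \<open>k - t - 2\<close> in \<open>G'\<close>. For \<open>k \<ge> 4\<close> the excess is
  determined by the deck, so the same holds in \<open>G\<close>; but a connected set with \<open>b\<close> outer neighbours forces an
  excess of at least \<open>b - 2\<close>. Hence \<open>b \<le> k - t\<close> in both graphs after all. The exception
  \<open>(n, l) = (5, 2)\<close> is the case \<open>k = 3\<close>.
\<close>

section \<open>Edge counts and linked sets\<close>

definition deg :: "'a rel \<Rightarrow> 'a set \<Rightarrow> 'a \<Rightarrow> nat" where
  "deg E S v = card {u \<in> S. (v, u) \<in> E}"

text \<open>\<open>E\<close> is meant to be symmetric and loop-free, so every undirected edge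
  contributes two pairs.\<close>

definition ec :: "'a rel \<Rightarrow> 'a set \<Rightarrow> nat" where
  "ec E S = card (E \<inter> S \<times> S) div 2"

text \<open>Connectedness of an induced subgraph, expressed by cuts.\<close>
definition linked :: "'a rel \<Rightarrow> 'a set \<Rightarrow> bool" where
  "linked E S \<longleftrightarrow> S \<noteq> {} \<and> (\<forall>A. A \<subset> S \<longrightarrow> A \<noteq> {} \<longrightarrow> (\<exists>x\<in>A. \<exists>y\<in>S - A. (x, y) \<in> E))"

definition bdry :: "'a rel \<Rightarrow> 'a set \<Rightarrow> 'a set" where
  "bdry E Q = E `` Q - Q"

lemma linkedD:
  "linked E S \<Longrightarrow> A \<subset> S \<Longrightarrow> A \<noteq> {} \<Longrightarrow> \<exists>x\<in>A. \<exists>y\<in>S - A. (x, y) \<in> E"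
  unfolding linked_def by blast

locale ugraph =
  fixes V :: "'a set" and E :: "'a rel"
  assumes finite_V: "finite V"
    and E_subset: "E \<subseteq> V \<times> V"
    and sym_E: "(x, y) \<in> E \<Longrightarrow> (y, x) \<in> E"
    and irrefl_E: "(x, x) \<notin> E"
begin

lemma finite_sub: "S \<subseteq> V \<Longrightarrow> finite S"
  using finite_V finite_subset by blast

lemma finite_E: "finite E"
  using E_subset finite_V by (meson finite_SigmaI finite_subset)

lemma bdry_subset: "bdry E Q \<subseteq> V"
  using E_subset by (auto simp: bdry_def)

lemma finite_bdry: "finite (bdry E Q)"
  using bdry_subset finite_sub by blast

lemma ec_empty: "ec E {} = 0"
  by (simp add: ec_def)

lemma ec_insert:
  assumes "finite S" "v \<notin> S"
  shows "ec E (insert v S) = ec E S + deg E S v"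
proof -
  let ?N = "{u \<in> S. (v, u) \<in> E}"
  have eq: "E \<inter> insert v S \<times> insert v S = (E \<inter> S \<times> S) \<union> (({v} \<times> ?N) \<union> (?N \<times> {v}))"
    using sym_E irrefl_E by auto
  have "card (({v} \<times> ?N) \<union> (?N \<times> {v})) = card ({v} \<times> ?N) + card (?N \<times> {v})"
    using assms by (intro card_Un_disjoint) auto
  also have "\<dots> = 2 * deg E S v" by (simp add: deg_def card_cartesian_product)
  finally have "card (E \<inter> insert v S \<times> insert v S) = card (E \<inter> S \<times> S) + 2 * deg E S v"
    unfolding eq using assms by (subst card_Un_disjoint) auto
  \<comment> \<open>Adding an even number commutes with \<open>div 2\<close>, whatever the parity of
    the old count.\<close>
  then show ?thesis by (simp add: ec_def)
qed

lemma ec_singleton: "ec E {v} = 0"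
  using ec_insert[of "{}" v] by (simp add: ec_empty deg_def)

lemma deg_insert:
  assumes "finite S" "v \<notin> S"
  shows "deg E (insert v S) u = deg E S u + (if (u, v) \<in> E then 1 else 0)"
proof -
  have "{w \<in> insert v S. (u, w) \<in> E} =
    (if (u, v) \<in> E then insert v {w \<in> S. (u, w) \<in> E} else {w \<in> S. (u, w) \<in> E})" by auto
  then show ?thesis using assms by (simp add: deg_def)
qed

lemma deg_self: "deg E (insert v S) v = deg E S v"
proof -
  have "{u \<in> insert v S. (v, u) \<in> E} = {u \<in> S. (v, u) \<in> E}" using irrefl_E by auto
  then show ?thesis by (simp add: deg_def)
qed

lemma deg_Un:
  assumes "finite A" "finite B" "A \<inter> B = {}"
  shows "deg E (A \<union> B) v = deg E A v + deg E B v"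
proof -
  have "{u \<in> A \<union> B. (v, u) \<in> E} = {u \<in> A. (v, u) \<in> E} \<union> {u \<in> B. (v, u) \<in> E}" by auto
  then show ?thesis unfolding deg_def using assms by (simp, subst card_Un_disjoint) auto
qed

lemma deg_mono: "S \<subseteq> T \<Longrightarrow> finite T \<Longrightarrow> deg E S v \<le> deg E T v"
  unfolding deg_def by (rule card_mono) auto

text \<open>The handshake lemma: a new vertex contributes its degree once itself and once spread
  over its neighbours.\<close>

lemma sum_deg: "finite S \<Longrightarrow> (\<Sum>v\<in>S. deg E S v) = 2 * ec E S"
proof (induction S rule: finite_induct)
  case empty
  then show ?case by (simp add: ec_empty)
next
  case (insert v S)
  have "(\<Sum>u\<in>insert v S. deg E (insert v S) u)
      = deg E S v + (\<Sum>u\<in>S. deg E S u + (if (u, v) \<in> E then 1 else 0))"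
    using insert by (simp add: deg_self deg_insert irrefl_E)
  also have "(\<Sum>u\<in>S. deg E S u + (if (u, v) \<in> E then 1 else 0)) = 2 * ec E S + deg E S v"
  proof -
    have "(\<Sum>u\<in>S. (if (u, v) \<in> E then 1 else 0::nat)) = card {u \<in> S. (u, v) \<in> E}"
      using insert by (simp add: sum.If_cases Int_def)
    also have "\<dots> = deg E S v" unfolding deg_def using sym_E by (metis (lifting))
    finally show ?thesis using insert by (simp add: sum.distrib)
  qed
  finally show ?case using insert by (simp add: ec_insert)
qed

lemma ec_Un:
  assumes "finite A" "finite B" "A \<inter> B = {}"
  shows "ec E (A \<union> B) = ec E A + ec E B + (\<Sum>a\<in>A. deg E B a)"
  using assms
proof (induction A rule: finite_induct)
  case empty
  then show ?case by (simp add: ec_empty)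
next
  case (insert a A)
  then have "ec E (insert a A \<union> B) = ec E (A \<union> B) + deg E (A \<union> B) a"
    using ec_insert[of "A \<union> B" a] by simp
  moreover have "deg E (A \<union> B) a = deg E A a + deg E B a"
    using insert by (intro deg_Un) auto
  ultimately show ?case using insert by (simp add: ec_insert)
qed

lemma deg_pos: "finite S \<Longrightarrow> u \<in> S \<Longrightarrow> (v, u) \<in> E \<Longrightarrow> 0 < deg E S v"
  unfolding deg_def by (subst card_gt_0_iff) auto

text \<open>Vertices minus edges does not rise while \<open>C\<close> grows to \<open>S\<close>: an
  edge leaves \<open>C\<close> as long as it is not \<open>S\<close>, and adding the outer end of
  that edge adds at least one edge.\<close>

lemma linked_grow:
  assumes "linked E S" "finite S" "C \<subseteq> S" "C \<noteq> {}"
  shows "ec E C + card S \<le> ec E S + card C"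
  using assms
proof (induction "card (S - C)" arbitrary: C rule: less_induct)
  case less
  show ?case
  proof (cases "C = S")
    case False
    then obtain x y where xy: "x \<in> C" "y \<in> S - C" "(x, y) \<in> E"
      using less.prems unfolding linked_def by (meson psubsetI)
    have fin: "finite C" using less.prems finite_subset by blast
    have "S - insert y C \<subset> S - C" using xy by auto
    then have "card (S - insert y C) < card (S - C)"
      using less.prems by (intro psubset_card_mono) auto
    then have "ec E (insert y C) + card S \<le> ec E S + card (insert y C)"
      using less xy by (intro less.hyps) auto
    moreover have "ec E (insert y C) = ec E C + deg E C y"
      using xy fin by (intro ec_insert) auto
    moreover have "0 < deg E C y" using xy fin sym_E by (intro deg_pos) auto
    ultimately show ?thesis using xy fin by simp
  qed simp
qed

lemma linked_ec:
  assumes "linked E S" "finite S"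
  shows "card S \<le> ec E S + 1"
proof -
  obtain v where "v \<in> S" using assms by (auto simp: linked_def)
  then show ?thesis using linked_grow[of S "{v}"] assms by (simp add: ec_singleton)
qed

lemma linked_insert:
  assumes "linked E Q" "y \<in> bdry E Q"
  shows "linked E (insert y Q)"
  unfolding linked_def
proof (intro conjI allI impI)
  fix A assume A: "A \<subset> insert y Q" "A \<noteq> {}"
  obtain q where q: "q \<in> Q" "(q, y) \<in> E" "y \<notin> Q" using assms by (auto simp: bdry_def)
  show "\<exists>x\<in>A. \<exists>z\<in>insert y Q - A. (x, z) \<in> E"
  \<comment> \<open>A cut that does not cut \<open>Q\<close> separates \<open>y\<close> from
    \<open>Q\<close> and is crossed by the edge between \<open>q\<close> and
    \<open>y\<close>.\<close>
  proof (cases "A \<inter> Q = {} \<or> Q \<subseteq> A")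
    case True
    then show ?thesis
    proof
      assume "A \<inter> Q = {}"
      then have "A = {y}" using A by auto
      then show ?thesis using q sym_E by auto
    next
      assume "Q \<subseteq> A"
      then have "A = Q" using A by auto
      then show ?thesis using q by auto
    qed
  next
    case False
    then have "A \<inter> Q \<subset> Q" "A \<inter> Q \<noteq> {}" by auto
    then show ?thesis using assms(1) unfolding linked_def by blast
  qed
qed simp

lemma ec_split:
  assumes "finite K" "A \<subseteq> K" "\<And>x y. x \<in> A \<Longrightarrow> y \<in> K - A \<Longrightarrow> (x, y) \<notin> E"
  shows "ec E K = ec E A + ec E (K - A)"
proof -
  have "deg E (K - A) a = 0" if "a \<in> A" for a
  proof -
    have "{u \<in> K - A. (a, u) \<in> E} = {}" using that assms(3) by auto
    then show ?thesis unfolding deg_def by (metis card.empty)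
  qed
  then have "ec E (A \<union> (K - A)) = ec E A + ec E (K - A)"
    using assms by (subst ec_Un) (auto intro: finite_subset)
  moreover have "A \<union> (K - A) = K" using assms by auto
  ultimately show ?thesis by simp
qed

end

section \<open>Isomorphism-invariant counts from the deck\<close>

definition emb :: "('a \<Rightarrow> 'c) \<Rightarrow> 'a set \<Rightarrow> 'a rel \<Rightarrow> 'c rel \<Rightarrow> bool" where
  "emb f X E E' \<longleftrightarrow> inj_on f X \<and> (\<forall>x\<in>X. \<forall>y\<in>X. (x, y) \<in> E \<longleftrightarrow> (f x, f y) \<in> E')"

text \<open>Equality of decks in the form in which it is used: all isomorphism-invariant counts agree.\<close>
definition same_deck :: "nat \<Rightarrow> 'a set \<Rightarrow> 'a rel \<Rightarrow> 'c set \<Rightarrow> 'c rel \<Rightarrow> bool" where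
  "same_deck k V E V' E' \<longleftrightarrow> (\<forall>(\<phi> :: 'a set \<Rightarrow> nat) \<phi>'.
     (\<forall>f X. X \<subseteq> V \<longrightarrow> card X = k \<longrightarrow> f ` X \<subseteq> V' \<longrightarrow> emb f X E E' \<longrightarrow> \<phi> X = \<phi>' (f ` X)) \<longrightarrow>
     (\<Sum>X | X \<subseteq> V \<and> card X = k. \<phi> X) = (\<Sum>X | X \<subseteq> V' \<and> card X = k. \<phi>' X))"

lemma same_deckD:
  fixes \<phi> :: "'a set \<Rightarrow> nat"
  assumes "same_deck k V E V' E'"
    and "\<And>f X. X \<subseteq> V \<Longrightarrow> card X = k \<Longrightarrow> f ` X \<subseteq> V' \<Longrightarrow> emb f X E E' \<Longrightarrow> \<phi> X = \<phi>' (f ` X)"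
  shows "(\<Sum>X | X \<subseteq> V \<and> card X = k. \<phi> X) = (\<Sum>X | X \<subseteq> V' \<and> card X = k. \<phi>' X)"
  using assms unfolding same_deck_def by blast

lemma emb_subset: "emb f X E E' \<Longrightarrow> Y \<subseteq> X \<Longrightarrow> emb f Y E E'"
  unfolding emb_def by (meson inj_on_subset subsetD)

lemma card_supersets:
  assumes "finite V" "X \<subseteq> V" "card X = j" "j \<le> k"
  shows "card {Y. X \<subseteq> Y \<and> Y \<subseteq> V \<and> card Y = k} = (card V - j) choose (k - j)"
proof -
  have fX: "finite X" using assms finite_subset by blast
  have "bij_betw (\<lambda>Z. X \<union> Z) {Z. Z \<subseteq> V - X \<and> card Z = k - j} {Y. X \<subseteq> Y \<and> Y \<subseteq> V \<and> card Y = k}"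
  proof (rule bij_betw_byWitness[where f' = "\<lambda>Y. Y - X"])
    show "(\<lambda>Z. X \<union> Z) ` {Z. Z \<subseteq> V - X \<and> card Z = k - j} \<subseteq> {Y. X \<subseteq> Y \<and> Y \<subseteq> V \<and> card Y = k}"
    proof safe
      fix Z assume Z: "Z \<subseteq> V - X" "card Z = k - j"
      then have "finite Z" using assms by (meson finite_Diff finite_subset)
      then show "card (X \<union> Z) = k" using Z assms fX by (subst card_Un_disjoint) auto
    qed (use assms in auto)
    show "(\<lambda>Y. Y - X) ` {Y. X \<subseteq> Y \<and> Y \<subseteq> V \<and> card Y = k} \<subseteq> {Z. Z \<subseteq> V - X \<and> card Z = k - j}"
      using assms fX by (auto simp: card_Diff_subset)
  qed auto
  then have "card {Y. X \<subseteq> Y \<and> Y \<subseteq> V \<and> card Y = k} = card {Z. Z \<subseteq> V - X \<and> card Z = k - j}"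
    by (rule bij_betw_same_card[symmetric])
  also have "\<dots> = card (V - X) choose (k - j)"
    using assms by (intro n_subsets) auto
  also have "card (V - X) = card V - j"
    using assms fX by (simp add: card_Diff_subset)
  finally show ?thesis .
qed

text \<open>Double counting of the pairs \<open>X \<subseteq> Y\<close>: every \<open>X\<close> lies
  in equally many \<open>Y\<close>.\<close>

lemma sum_subsets_subsets:
  fixes \<phi> :: "'a set \<Rightarrow> nat"
  assumes "finite V" "j \<le> k"
  shows "(\<Sum>Y | Y \<subseteq> V \<and> card Y = k. \<Sum>X | X \<subseteq> Y \<and> card X = j. \<phi> X)
    = ((card V - j) choose (k - j)) * (\<Sum>X | X \<subseteq> V \<and> card X = j. \<phi> X)"
proof -
  let ?K = "{Y. Y \<subseteq> V \<and> card Y = k}" and ?J = "{X. X \<subseteq> V \<and> card X = j}"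
  have fin: "finite ?K" "finite ?J" using assms by auto
  have "(\<Sum>Y\<in>?K. \<Sum>X | X \<subseteq> Y \<and> card X = j. \<phi> X) = (\<Sum>Y\<in>?K. \<Sum>X | X \<in> ?J \<and> X \<subseteq> Y. \<phi> X)"
    by (intro sum.cong) auto
  also have "\<dots> = (\<Sum>X\<in>?J. \<Sum>Y | Y \<in> ?K \<and> X \<subseteq> Y. \<phi> X)"
    by (rule sum.swap_restrict[OF fin])
  also have "\<dots> = (\<Sum>X\<in>?J. ((card V - j) choose (k - j)) * \<phi> X)"
  proof (intro sum.cong refl)
    fix X assume "X \<in> ?J"
    moreover have "{Y. Y \<in> ?K \<and> X \<subseteq> Y} = {Y. X \<subseteq> Y \<and> Y \<subseteq> V \<and> card Y = k}" by auto
    ultimately show "(\<Sum>Y | Y \<in> ?K \<and> X \<subseteq> Y. \<phi> X) = ((card V - j) choose (k - j)) * \<phi> X"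
      using card_supersets[OF assms(1) _ _ assms(2)] by simp
  qed
  finally show ?thesis by (simp add: sum_distrib_left)
qed

lemma image_card_subsets:
  assumes inj: "inj_on f Y"
  shows "{X. X \<subseteq> f ` Y \<and> card X = j} = (`) f ` {X. X \<subseteq> Y \<and> card X = j}"
proof (intro set_eqI iffI)
    fix X assume "X \<in> {X. X \<subseteq> f ` Y \<and> card X = j}"
    then have X: "X \<subseteq> f ` Y" "card X = j" by simp_all
    obtain Z where Z: "Z \<subseteq> Y" "X = f ` Z" using X(1) by (rule subset_imageE)
    moreover have "card (f ` Z) = card Z" using inj_on_subset[OF inj Z(1)] by (rule card_image)
    ultimately show "X \<in> (`) f ` {X. X \<subseteq> Y \<and> card X = j}"
      using X by (intro image_eqI[of _ _ Z]) simp_all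
next
    fix X assume "X \<in> (`) f ` {X. X \<subseteq> Y \<and> card X = j}"
    then obtain Z where Z: "Z \<subseteq> Y" "X = f ` Z" "card Z = j" by blast
    then have "card X = j" using card_image[OF inj_on_subset[OF inj Z(1)]] by simp
    then show "X \<in> {X. X \<subseteq> f ` Y \<and> card X = j}" using Z by (simp add: image_mono)
qed

text \<open>Kelly's argument: summing over the \<open>j\<close>-subsets of a \<open>k\<close>-set
  gives an invariant of \<open>k\<close>-sets, whose total is the wanted sum times a binomial
  coefficient, positive since \<open>j \<le> k \<le> card V\<close>.\<close>

lemma same_deck_mono:
  assumes deck: "same_deck k V E V' E'" and fin: "finite V" "finite V'"
    and "card V = card V'" "k \<le> card V" "j \<le> k"
  shows "same_deck j V E V' E'"
  unfolding same_deck_def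
proof (intro allI impI)
  fix \<phi> :: "'a set \<Rightarrow> nat" and \<phi>'
  assume inv: "\<forall>f X. X \<subseteq> V \<longrightarrow> card X = j \<longrightarrow> f ` X \<subseteq> V' \<longrightarrow> emb f X E E' \<longrightarrow> \<phi> X = \<phi>' (f ` X)"
  have "(\<Sum>Y | Y \<subseteq> V \<and> card Y = k. \<Sum>X | X \<subseteq> Y \<and> card X = j. \<phi> X)
      = (\<Sum>Y | Y \<subseteq> V' \<and> card Y = k. \<Sum>X | X \<subseteq> Y \<and> card X = j. \<phi>' X)"
  proof (rule same_deckD[OF deck])
    fix f Y assume Y: "Y \<subseteq> V" "card Y = k" "f ` Y \<subseteq> V'" "emb f Y E E'"
    then have inj: "inj_on f Y" by (simp add: emb_def)
    have "inj_on ((`) f) {X. X \<subseteq> Y \<and> card X = j}"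
      using inj by (rule inj_on_subset[OF inj_on_image_Pow]) auto
    then have "(\<Sum>X | X \<subseteq> f ` Y \<and> card X = j. \<phi>' X) = (\<Sum>X | X \<subseteq> Y \<and> card X = j. \<phi>' (f ` X))"
      unfolding image_card_subsets[OF inj] by (rule sum.reindex[unfolded o_def])
    also have "\<dots> = (\<Sum>X | X \<subseteq> Y \<and> card X = j. \<phi> X)"
    proof (rule sum.cong[OF refl])
      fix X assume "X \<in> {X. X \<subseteq> Y \<and> card X = j}"
      then have "X \<subseteq> V" "card X = j" "f ` X \<subseteq> V'" "emb f X E E'"
        using Y emb_subset[OF Y(4), of X] by auto
      then show "\<phi>' (f ` X) = \<phi> X" using inv by metis
    qed
    finally show "(\<Sum>X | X \<subseteq> Y \<and> card X = j. \<phi> X) = (\<Sum>X | X \<subseteq> f ` Y \<and> card X = j. \<phi>' X)" ..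
  qed
  then have "((card V - j) choose (k - j)) * (\<Sum>X | X \<subseteq> V \<and> card X = j. \<phi> X)
      = ((card V - j) choose (k - j)) * (\<Sum>X | X \<subseteq> V' \<and> card X = j. \<phi>' X)"
    using sum_subsets_subsets[OF fin(1) \<open>j \<le> k\<close>, of \<phi>] sum_subsets_subsets[OF fin(2) \<open>j \<le> k\<close>, of \<phi>']
      \<open>card V = card V'\<close> by simp
  moreover have "0 < (card V - j) choose (k - j)"
    using assms by (intro zero_less_binomial) auto
  ultimately show "(\<Sum>X | X \<subseteq> V \<and> card X = j. \<phi> X) = (\<Sum>X | X \<subseteq> V' \<and> card X = j. \<phi>' X)"
    by simp
qed

section \<open>Counting sets by the number of their outer neighbours\<close>

definition family :: "'a set \<Rightarrow> nat \<Rightarrow> ('a set \<Rightarrow> bool) \<Rightarrow> 'a set set" where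
  "family V t P = {Q. Q \<subseteq> V \<and> card Q = t \<and> P Q}"

definition invariant :: "'a rel \<Rightarrow> 'c rel \<Rightarrow> ('a set \<Rightarrow> bool) \<Rightarrow> ('c set \<Rightarrow> bool) \<Rightarrow> bool" where
  "invariant E E' P P' \<longleftrightarrow> (\<forall>f X. emb f X E E' \<longrightarrow> P X = P' (f ` X))"

text \<open>Double counting of pairs with
  \<open>Q \<subseteq> Z \<subseteq> Q \<union> bdry E Q\<close>. For fixed \<open>Q\<close>,
  choosing \<open>Z\<close> means choosing \<open>j\<close> outer neighbours; on the right the pairs
  are grouped by \<open>Z\<close>, which makes a sum over vertex sets of one size.\<close>

lemma (in ugraph) sum_choose_bdry:
  assumes "t > 0"
  shows "(\<Sum>Q\<in>family V t P. card (bdry E Q) choose j)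
    = (\<Sum>Z | Z \<subseteq> V \<and> card Z = t + j. card {Q. Q \<subseteq> Z \<and> card Q = t \<and> P Q \<and> Z \<subseteq> Q \<union> bdry E Q})"
proof -
  let ?F = "family V t P" and ?K = "{Z. Z \<subseteq> V \<and> card Z = t + j}"
  let ?R = "\<lambda>Q Z. Q \<subseteq> Z \<and> Z \<subseteq> Q \<union> bdry E Q"
  have fin: "finite ?F" "finite ?K" using finite_V by (auto simp: family_def)
  have "card (bdry E Q) choose j = (\<Sum>Z | Z \<in> ?K \<and> ?R Q Z. 1)" if Q: "Q \<in> ?F" for Q
  proof -
    let ?W = "Q \<union> bdry E Q"
    have fQ: "finite Q" and cQ: "card Q = t" "Q \<subseteq> V" using Q finite_sub by (auto simp: family_def)
    have "card ?W = t + card (bdry E Q)"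
      using fQ cQ finite_bdry by (subst card_Un_disjoint) (auto simp: bdry_def)
    moreover have "{Z. Z \<in> ?K \<and> ?R Q Z} = {Z. Q \<subseteq> Z \<and> Z \<subseteq> ?W \<and> card Z = t + j}"
      using cQ bdry_subset[of Q] by auto
    moreover have "card {Z. Q \<subseteq> Z \<and> Z \<subseteq> ?W \<and> card Z = t + j} = (card ?W - t) choose (t + j - t)"
      using fQ cQ finite_bdry by (intro card_supersets) auto
    ultimately show ?thesis by simp
  qed
  then have "(\<Sum>Q\<in>?F. card (bdry E Q) choose j) = (\<Sum>Q\<in>?F. \<Sum>Z | Z \<in> ?K \<and> ?R Q Z. 1)"
    by (rule sum.cong[OF refl])
  also have "\<dots> = (\<Sum>Z\<in>?K. \<Sum>Q | Q \<in> ?F \<and> ?R Q Z. 1)"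
    by (rule sum.swap_restrict[OF fin])
  also have "\<dots> = (\<Sum>Z\<in>?K. card {Q. Q \<subseteq> Z \<and> card Q = t \<and> P Q \<and> Z \<subseteq> Q \<union> bdry E Q})"
    by (intro sum.cong refl) (auto simp: family_def intro!: arg_cong[where f = card])
  finally show ?thesis .
qed

text \<open>The boundary may leave \<open>Z\<close>, but which points of \<open>Z\<close> it
  contains depends only on edges inside \<open>Z\<close>.\<close>

lemma emb_bdry:
  assumes "emb f Z E E'" "Q \<subseteq> Z"
  shows "f ` Z \<subseteq> f ` Q \<union> bdry E' (f ` Q) \<longleftrightarrow> Z \<subseteq> Q \<union> bdry E Q"
proof -
  have iff: "f z \<in> f ` Q \<union> bdry E' (f ` Q) \<longleftrightarrow> z \<in> Q \<union> bdry E Q" if z: "z \<in> Z" for z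
  proof -
    have "f z \<in> f ` Q \<longleftrightarrow> z \<in> Q"
      using inj_on_image_mem_iff[of f Z z Q] z assms by (simp add: emb_def)
    moreover have "f z \<in> E' `` (f ` Q) \<longleftrightarrow> z \<in> E `` Q"
    proof -
      have "(f q, f z) \<in> E' \<longleftrightarrow> (q, z) \<in> E" if "q \<in> Q" for q
        using that z assms unfolding emb_def by blast
      then show ?thesis by (simp add: Image_iff bex_simps)
    qed
    ultimately show ?thesis by (simp add: bdry_def)
  qed
  have "f ` Z \<subseteq> f ` Q \<union> bdry E' (f ` Q) \<longleftrightarrow> (\<forall>z\<in>Z. f z \<in> f ` Q \<union> bdry E' (f ` Q))"
    by (rule image_subset_iff)
  also have "\<dots> \<longleftrightarrow> Z \<subseteq> Q \<union> bdry E Q" using iff by (simp add: subset_eq)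
  finally show ?thesis .
qed

locale ugraph_pair = G: ugraph V E + G': ugraph V' E'
  for V :: "'a set" and E and V' :: "'c set" and E' +
  fixes k :: nat
  assumes card_V: "card V = card V'"
    and k_le: "k \<le> card V"
    and deck: "same_deck k V E V' E'"
begin

lemma deck_le: "j \<le> k \<Longrightarrow> same_deck j V E V' E'"
  using same_deck_mono deck G.finite_V G'.finite_V card_V k_le by blast

text \<open>After double counting, the summand at \<open>Z\<close> is isomorphism-invariant: an
  embedding of \<open>Z\<close> carries the sets \<open>Q\<close> counted for \<open>Z\<close>
  bijectively to those counted for its image.\<close>

lemma sum_choose_bdry_eq:
  assumes inv: "invariant E E' P P'" and "t > 0" "t + j \<le> k"
  shows "(\<Sum>Q\<in>family V t P. card (bdry E Q) choose j) = (\<Sum>Q\<in>family V' t P'. card (bdry E' Q) choose j)"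
  unfolding G.sum_choose_bdry[OF \<open>t > 0\<close>] G'.sum_choose_bdry[OF \<open>t > 0\<close>]
proof (rule same_deckD[OF deck_le[OF assms(3)]])
  fix f Z assume Z: "Z \<subseteq> V" "card Z = t + j" "f ` Z \<subseteq> V'" "emb f Z E E'"
  then have inj: "inj_on f Z" by (simp add: emb_def)
  let ?A = "{Q. Q \<subseteq> Z \<and> card Q = t \<and> P Q \<and> Z \<subseteq> Q \<union> bdry E Q}"
  let ?B = "{Q. Q \<subseteq> f ` Z \<and> card Q = t \<and> P' Q \<and> f ` Z \<subseteq> Q \<union> bdry E' Q}"
  have iff: "f ` Q \<in> ?B \<longleftrightarrow> Q \<in> ?A" if "Q \<subseteq> Z" for Q
  proof -
    have "card (f ` Q) = card Q" using inj that by (metis card_image inj_on_subset)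
    moreover have "P' (f ` Q) = P Q"
      using inv emb_subset[OF Z(4) that] unfolding invariant_def by blast
    ultimately show ?thesis using emb_bdry[OF Z(4) that] that by auto
  qed
  have "?B = (`) f ` ?A"
  proof (intro set_eqI iffI)
    fix X assume X: "X \<in> ?B"
    then have "X \<subseteq> f ` Z" by simp
    then obtain Q where "Q \<subseteq> Z" "X = f ` Q" by (rule subset_imageE)
    then show "X \<in> (`) f ` ?A" using X iff[of Q] by (intro image_eqI[of _ _ Q]) simp_all
  next
    fix X assume "X \<in> (`) f ` ?A"
    then obtain Q where "Q \<in> ?A" "X = f ` Q" by (rule imageE)
    then show "X \<in> ?B" using iff[of Q] by simp
  qed
  moreover have "inj_on ((`) f) ?A"
    using inj by (rule inj_on_subset[OF inj_on_image_Pow]) auto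
  ultimately show "card ?A = card ?B" by (simp add: card_image)
qed

end

text \<open>Newton interpolation: \<open>x choose Suc K\<close> vanishes for
  \<open>x \<le> K\<close> and is 1 at \<open>Suc K\<close>, so the values can be fitted one after
  the other.\<close>

lemma newton_coefficients:
  fixes f :: "nat \<Rightarrow> int"
  shows "\<exists>c. \<forall>x\<le>K. f x = (\<Sum>j\<le>K. c j * int (x choose j))"
proof (induction K)
  case 0
  show ?case by (intro exI[of _ f]) auto
next
  case (Suc K)
  then obtain c where c: "f x = (\<Sum>j\<le>K. c j * int (x choose j))" if "x \<le> K" for x by blast
  let ?d = "c(Suc K := f (Suc K) - (\<Sum>j\<le>K. c j * int (Suc K choose j)))"
  have "f x = (\<Sum>j\<le>Suc K. ?d j * int (x choose j))" if "x \<le> Suc K" for x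
  proof -
    have "(\<Sum>j\<le>K. ?d j * int (x choose j)) = (\<Sum>j\<le>K. c j * int (x choose j))"
      by (intro sum.cong) auto
    then have "(\<Sum>j\<le>Suc K. ?d j * int (x choose j))
        = (\<Sum>j\<le>K. c j * int (x choose j)) + ?d (Suc K) * int (x choose Suc K)"
      by simp
    then show ?thesis using that c by (cases "x = Suc K") (auto simp: binomial_eq_0)
  qed
  then show ?case by blast
qed

lemma sum_newton:
  fixes g :: "nat \<Rightarrow> int"
  assumes "\<And>x. x \<le> K \<Longrightarrow> g x = (\<Sum>j\<le>K. c j * int (x choose j))" and "\<And>Q. Q \<in> F \<Longrightarrow> b Q \<le> K"
  shows "(\<Sum>Q\<in>F. g (b Q)) = (\<Sum>j\<le>K. c j * int (\<Sum>Q\<in>F. b Q choose j))"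
proof -
  have "(\<Sum>Q\<in>F. g (b Q)) = (\<Sum>Q\<in>F. \<Sum>j\<le>K. c j * int (b Q choose j))"
    using assms by (intro sum.cong) auto
  also have "\<dots> = (\<Sum>j\<le>K. \<Sum>Q\<in>F. c j * int (b Q choose j))" by (rule sum.swap)
  finally show ?thesis by (simp add: sum_distrib_left)
qed

context ugraph_pair
begin

text \<open>If no boundary exceeds \<open>K\<close>, every function of the boundary size is a
  combination of the binomials \<open>x choose j\<close> with \<open>j \<le> K\<close>, whose sums
  agree by \<open>sum_choose_bdry_eq\<close>.\<close>

lemma sum_bdry_eq:
  fixes g :: "nat \<Rightarrow> int"
  assumes inv: "invariant E E' P P'" and "t > 0" "t + K \<le> k"
    and "\<And>Q. Q \<in> family V t P \<Longrightarrow> card (bdry E Q) \<le> K"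
    and "\<And>Q. Q \<in> family V' t P' \<Longrightarrow> card (bdry E' Q) \<le> K"
  shows "(\<Sum>Q\<in>family V t P. g (card (bdry E Q))) = (\<Sum>Q\<in>family V' t P'. g (card (bdry E' Q)))"
proof -
  obtain c where c: "g x = (\<Sum>j\<le>K. c j * int (x choose j))" if "x \<le> K" for x
    using newton_coefficients[of K g] by blast
  have "(\<Sum>Q\<in>family V t P. g (card (bdry E Q)))
      = (\<Sum>j\<le>K. c j * int (\<Sum>Q\<in>family V t P. card (bdry E Q) choose j))"
    using assms by (intro sum_newton[OF c]) auto
  also have "\<dots> = (\<Sum>j\<le>K. c j * int (\<Sum>Q\<in>family V' t P'. card (bdry E' Q) choose j))"
    using assms by (intro sum.cong refl) (simp add: sum_choose_bdry_eq[OF inv])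
  also have "\<dots> = (\<Sum>Q\<in>family V' t P'. g (card (bdry E' Q)))"
    using assms by (intro sum_newton[OF c, symmetric]) auto
  finally show ?thesis .
qed

end

section \<open>Cycles around neighbourhoods and degree excess\<close>

context ugraph
begin

lemma sum_deg_cross:
  assumes "finite A" "finite B"
  shows "(\<Sum>a\<in>A. deg E B a) = card (E \<inter> A \<times> B)"
proof -
  have "E \<inter> A \<times> B = (SIGMA a:A. {b \<in> B. (a, b) \<in> E})" by auto
  then show ?thesis using assms by (simp add: deg_def)
qed

lemma deg_V: "deg E V v = card (E `` {v})"
  unfolding deg_def using E_subset by (intro arg_cong[where f = card]) auto

text \<open>Turns the counts for \<open>t = 1\<close> into statements about degrees.\<close>

lemma sum_family_singletons:
  fixes g :: "nat \<Rightarrow> 'n :: comm_monoid_add"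
  shows "(\<Sum>Q\<in>family V 1 (\<lambda>_. True). g (card (bdry E Q))) = (\<Sum>v\<in>V. g (deg E V v))"
proof -
  have "family V 1 (\<lambda>_. True) = (\<lambda>v. {v}) ` V"
    by (auto simp: family_def card_1_singleton_iff)
  moreover have "bdry E {v} = E `` {v}" for v using irrefl_E by (auto simp: bdry_def)
  ultimately show ?thesis by (simp add: sum.reindex deg_V)
qed

text \<open>Take a smallest nonempty closed set with fewer edges than vertices. A cut without
  crossing edges would split it into two closed parts, one of which again has too few edges.\<close>

lemma exists_tree_component:
  assumes "V \<noteq> {}" "ec E V < card V"
  obtains T where "T \<subseteq> V" "linked E T" "ec E T + 1 = card T" "E `` T \<subseteq> T"
proof -
  let ?P = "\<lambda>T. T \<subseteq> V \<and> T \<noteq> {} \<and> E `` T \<subseteq> T \<and> ec E T < card T"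
  have "?P V" using assms E_subset by auto
  from ex_has_least_nat[of ?P, OF this, of card] obtain T
    where T: "?P T" and least: "\<And>S. ?P S \<Longrightarrow> card T \<le> card S" by blast
  have fin: "finite T" using T finite_sub by blast
  have "linked E T"
    unfolding linked_def
  proof (intro conjI allI impI)
    fix A assume A: "A \<subset> T" "A \<noteq> {}"
    show "\<exists>x\<in>A. \<exists>y\<in>T - A. (x, y) \<in> E"
    proof (rule ccontr)
      assume "\<not> (\<exists>x\<in>A. \<exists>y\<in>T - A. (x, y) \<in> E)"
      then have no: "(x, y) \<notin> E" if "x \<in> A" "y \<in> T - A" for x y using that by blast
      have sizes: "card A < card T" "card (T - A) < card T" "card T = card A + card (T - A)"
        using A fin by (auto intro!: psubset_card_mono simp: card_Diff_subset finite_subset card_mono)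
      have "ec E T = ec E A + ec E (T - A)"
        using A fin no by (intro ec_split) auto
      then have "ec E A < card A \<or> ec E (T - A) < card (T - A)" using T sizes by linarith
      moreover have "E `` A \<subseteq> A" "E `` (T - A) \<subseteq> T - A" using T A no sym_E by blast+
      ultimately have "?P A \<or> ?P (T - A)" using T A by auto
      then show False using least[of A] least[of "T - A"] sizes by linarith
    qed
  qed (use T in auto)
  moreover have "ec E T + 1 = card T" using linked_ec[OF calculation fin] T by simp
  ultimately show ?thesis using that T by blast
qed

text \<open>The complement of \<open>Y\<close> in \<open>M\<close> meets so many edges that a linked part \<open>K\<close> of it, chosen minimal, is
  joined to \<open>Y\<close> by two of them. Closing up via \<open>Q\<close> gives a set with a cycle and at most
  \<open>card (M - Y) + card Q + 2\<close> vertices, which must exceed \<open>k\<close>.\<close>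

lemma long_cycle_around:
  assumes M: "M \<subseteq> V" "card M \<le> ec E M"
    and small: "\<And>S. S \<subseteq> M \<Longrightarrow> S \<noteq> {} \<Longrightarrow> card S \<le> k \<Longrightarrow> ec E S < card S"
    and Q: "linked E Q" "Q \<subseteq> Y" "Y \<subseteq> Q \<union> bdry E Q"
    and Y: "Y \<subseteq> M" "card Y = k" and bound: "card M + card Q + 1 \<le> 2 * k"
  obtains C where "C \<subseteq> M" "card C = k + 1" "Q \<subseteq> C" "M - C \<subseteq> Y - Q" "k + 1 \<le> ec E C"
    and "card M + card Q + 1 = 2 * k"
proof -
  define W where "W = M - Y"
  have fin: "finite M" "finite Y" "finite W" "finite Q"
    using M Y Q finite_sub W_def by (auto intro: finite_subset)
  have W: "card M = card W + k" using fin Y card_mono[of M Y] by (simp add: W_def card_Diff_subset)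
  have "Q \<noteq> {}" using Q by (simp add: linked_def)
  then have "card Q > 0" using fin by auto
  \<comment> \<open>For \<open>A \<subseteq> W\<close> this counts the edges inside
    \<open>A \<union> Y\<close> that meet \<open>A\<close>.\<close>
  let ?f = "\<lambda>A. ec E A + (\<Sum>a\<in>A. deg E Y a)"
  let ?P = "\<lambda>A. A \<subseteq> W \<and> card A < ?f A"
  have f_Un: "ec E (A \<union> Y) = ?f A + ec E Y" if "A \<subseteq> W" for A
    using that fin by (subst ec_Un) (auto simp: W_def intro: finite_subset)
  \<comment> \<open>\<open>M\<close> spans at least \<open>card W + k\<close> edges and
    \<open>Y\<close> fewer than \<open>k\<close>, so more than \<open>card W\<close> edges meet
    \<open>W\<close>.\<close>
  have "?P W"
  proof -
    have "ec E Y < k" using small[of Y] Y Q \<open>Q \<noteq> {}\<close> by auto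
    moreover have "W \<union> Y = M" using Y by (auto simp: W_def)
    ultimately show ?thesis using f_Un[of W] M W by auto
  qed
  from ex_has_least_nat[of ?P, OF this, of card] obtain K
    where K: "?P K" and least: "\<And>A. ?P A \<Longrightarrow> card K \<le> card A" by blast
  have finK: "finite K" using K fin finite_subset by blast
  have "K \<noteq> {}" using K by (auto simp: ec_empty)
  \<comment> \<open>Across a cut without crossing edges \<open>?f\<close> is additive, so one side
    would be a smaller choice for \<open>K\<close>.\<close>
  have linkK: "linked E K"
    unfolding linked_def
  proof (intro conjI allI impI)
    fix A assume A: "A \<subset> K" "A \<noteq> {}"
    show "\<exists>x\<in>A. \<exists>y\<in>K - A. (x, y) \<in> E"
    proof (rule ccontr)
      assume "\<not> (\<exists>x\<in>A. \<exists>y\<in>K - A. (x, y) \<in> E)"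
      then have no: "(x, y) \<notin> E" if "x \<in> A" "y \<in> K - A" for x y using that by blast
      have sizes: "card A < card K" "card (K - A) < card K" "card K = card A + card (K - A)"
        using A finK by (auto intro!: psubset_card_mono simp: card_Diff_subset finite_subset card_mono)
      have "ec E K = ec E A + ec E (K - A)"
        using A finK no by (intro ec_split) auto
      moreover have "(\<Sum>a\<in>K. deg E Y a) = (\<Sum>a\<in>A. deg E Y a) + (\<Sum>a\<in>K - A. deg E Y a)"
        using A finK by (metis add.commute psubset_imp_subset sum.subset_diff)
      ultimately have "card A < ?f A \<or> card (K - A) < ?f (K - A)" using K sizes by linarith
      then have "?P A \<or> ?P (K - A)" using K A by auto
      then show False using least[of A] least[of "K - A"] sizes by linarith
    qed
  qed (use \<open>K \<noteq> {}\<close> in auto)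
  have "card K \<le> card W" using K fin by (simp add: card_mono)
  then have "ec E K < card K"
    using small[of K] K W bound \<open>K \<noteq> {}\<close> by (auto simp: W_def)
  \<comment> \<open>More than \<open>card K\<close> edges meet \<open>K\<close> but fewer than
    \<open>card K\<close> lie inside it.\<close>
  then have "2 \<le> card (E \<inter> K \<times> Y)"
    using K sum_deg_cross[OF finK fin(2)] by simp
  then obtain p q where pq: "p \<noteq> q" "p \<in> E \<inter> K \<times> Y" "q \<in> E \<inter> K \<times> Y"
  proof -
    from \<open>2 \<le> card (E \<inter> K \<times> Y)\<close> obtain P where "P \<subseteq> E \<inter> K \<times> Y" "card P = 2"
      by (rule obtain_subset_with_card_n)
    then show ?thesis using that unfolding card_2_iff by blast
  qed
  \<comment> \<open>The two ends in \<open>Y\<close> may coincide. \<open>D\<close> is linked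
    because all of \<open>Y\<close> lies in the closed neighbourhood of \<open>Q\<close>.\<close>
  define D where "D = insert (snd p) (insert (snd q) Q)"
  have D: "Q \<subseteq> D" "D \<subseteq> Y" "finite D" using pq Q fin by (auto simp: D_def)
  have grow: "linked E (insert y Q')" if "linked E Q'" "Q \<subseteq> Q'" "y \<in> Y" for y Q'
  proof (cases "y \<in> Q'")
    case True
    then show ?thesis using that by (simp add: insert_absorb)
  next
    case False
    then have "y \<in> E `` Q" using that Q unfolding bdry_def by blast
    then have "y \<in> bdry E Q'" using that False unfolding bdry_def by blast
    then show ?thesis using linked_insert that by blast
  qed
  have "snd p \<in> Y" "snd q \<in> Y" using pq by auto
  then have "linked E D" unfolding D_def using Q(1) by (intro grow) auto
  then have "card D \<le> ec E D + 1" using linked_ec D by blast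
  have cD: "card D \<le> card Q + 2" unfolding D_def using fin by (simp add: card_insert_if)
  have disj: "K \<inter> D = {}" using K D by (auto simp: W_def)
  have "{p, q} \<subseteq> E \<inter> K \<times> D" using pq by (cases p; cases q) (simp add: D_def)
  then have "card {p, q} \<le> card (E \<inter> K \<times> D)" using finite_E by (intro card_mono) auto
  then have "2 \<le> card (E \<inter> K \<times> D)" using pq by simp
  \<comment> \<open>Two linked parts, each lacking at most one edge against its vertices, joined by
    two edges: \<open>C\<close> has at least as many edges as vertices.\<close>
  define C where "C = K \<union> D"
  have "ec E C = ec E K + ec E D + card (E \<inter> K \<times> D)"
    unfolding C_def using finK D disj by (simp add: ec_Un sum_deg_cross)
  moreover have cC: "card C = card K + card D"
    unfolding C_def using finK D disj by (simp add: card_Un_disjoint)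
  ultimately have ecC: "card C \<le> ec E C"
    using \<open>card D \<le> ec E D + 1\<close> \<open>2 \<le> card (E \<inter> K \<times> D)\<close> linked_ec[OF linkK finK] by linarith
  have CM: "C \<subseteq> M" using K D Y by (auto simp: C_def W_def)
  have "C \<noteq> {}" using \<open>K \<noteq> {}\<close> by (auto simp: C_def)
  then have "k < card C" using small[OF CM] ecC by (meson leD leI)
  \<comment> \<open>Also \<open>card C \<le> card W + card Q + 2 \<le> k + 1\<close>, so all these
    estimates are equalities.\<close>
  then have eqs: "card C = k + 1" "card K = card W" "card M + card Q + 1 = 2 * k"
    using cC cD \<open>card K \<le> card W\<close> W bound by linarith+
  then have "K = W" using K fin by (simp add: card_subset_eq)
  then have "M - C \<subseteq> Y - Q" using D by (auto simp: C_def W_def)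
  moreover have "Q \<subseteq> C" using D by (auto simp: C_def)
  ultimately show ?thesis using that[of C] CM eqs ecC by simp
qed

text \<open>Deleting a vertex leaves fewer than \<open>k\<close> edges, so every degree is at least
  2. Summing the same estimate over \<open>C\<close> gives at most \<open>k + 1\<close> edges, so
  the average degree is at most 2.\<close>

lemma minimal_cyclic_regular:
  assumes "C \<subseteq> V" "card C = k + 1" "k \<ge> 2" "k + 1 \<le> ec E C"
    and small: "\<And>S. S \<subseteq> C \<Longrightarrow> S \<noteq> {} \<Longrightarrow> card S \<le> k \<Longrightarrow> ec E S < card S"
    and "v \<in> C"
  shows "deg E C v = 2"
proof -
  have fin: "finite C" using assms finite_sub by blast
  have del: "ec E C + 1 \<le> k + deg E C u" if "u \<in> C" for u
  proof -
    have "card (C - {u}) = k" using that assms fin by simp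
    then have "ec E (C - {u}) < k" using small[of "C - {u}"] assms by fastforce
    moreover have "ec E C = ec E (C - {u}) + deg E C u"
      using ec_insert[of "C - {u}" u] deg_self[of u "C - {u}"] fin that by (simp add: insert_absorb)
    ultimately show ?thesis by simp
  qed
  then have ge: "2 \<le> deg E C u" if "u \<in> C" for u using that assms(4) by fastforce
  have "(\<Sum>u\<in>C. ec E C + 1) \<le> (\<Sum>u\<in>C. k + deg E C u)" using del by (intro sum_mono) auto
  then have "(k + 1) * (ec E C + 1) \<le> (k + 1) * k + 2 * ec E C"
    using assms sum_deg[OF fin] by (simp add: sum.distrib)
  \<comment> \<open>Collecting the terms in \<open>ec E C\<close> leaves the factor
    \<open>k - 1\<close>, which is positive and can be cancelled.\<close>
  then have "(k - 1) * ec E C \<le> (k - 1) * (k + 1)"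
    using \<open>k \<ge> 2\<close> by (cases k) (auto simp: algebra_simps)
  then have "0 < k - 1 \<longrightarrow> ec E C \<le> k + 1" by (simp only: mult_le_cancel1)
  then have "ec E C \<le> k + 1" using \<open>k \<ge> 2\<close> by simp
  then have "(\<Sum>u\<in>C. deg E C u) \<le> (\<Sum>u\<in>C. 2)" using sum_deg[OF fin] assms by simp
  moreover have "(\<Sum>u\<in>C. 2) \<le> (\<Sum>u\<in>C. deg E C u)" using ge by (rule sum_mono)
  ultimately have "(\<Sum>u\<in>C. deg E C u) = (\<Sum>u\<in>C. 2)" by (rule antisym)
  then show ?thesis using sum_mono_inv[of "\<lambda>_. 2" C "deg E C"] ge fin \<open>v \<in> C\<close> by metis
qed

text \<open>The subtraction on naturals makes this the total excess of the degrees over 2.\<close>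
definition excess :: nat where
  "excess = (\<Sum>v\<in>V. deg E V v - 2)"

lemma deg_le_excess: "v \<in> V \<Longrightarrow> deg E V v \<le> excess + 2"
  using member_le_sum[of v V "\<lambda>v. deg E V v - 2"] finite_V by (simp add: excess_def)

text \<open>The degrees in \<open>Q\<close> sum to at least
  \<open>2 * (card Q - 1) + card (bdry E Q)\<close>, since \<open>Q\<close> spans at least
  \<open>card Q - 1\<close> edges, and to at most \<open>2 * card Q + excess\<close>.\<close>

lemma bdry_le_excess:
  assumes "Q \<subseteq> V" "linked E Q"
  shows "card (bdry E Q) \<le> excess + 2"
proof -
  have fin: "finite Q" "finite (V - Q)" using assms finite_sub finite_V by auto
  have "deg E V v = deg E Q v + deg E (V - Q) v" for v
    using deg_Un[of Q "V - Q" v] fin assms by (simp add: Un_absorb1)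
  then have "(\<Sum>v\<in>Q. deg E V v) = 2 * ec E Q + card (E \<inter> Q \<times> (V - Q))"
    using fin by (simp add: sum.distrib sum_deg sum_deg_cross)
  moreover have "card (bdry E Q) \<le> card (E \<inter> Q \<times> (V - Q))"
  proof -
    have "bdry E Q = snd ` (E \<inter> Q \<times> (V - Q))" using E_subset by (force simp: bdry_def)
    then show ?thesis using finite_E by (metis card_image_le finite_Int)
  qed
  moreover have "card Q \<le> ec E Q + 1" using linked_ec assms fin by blast
  moreover have "(\<Sum>v\<in>Q. deg E V v) \<le> (\<Sum>v\<in>Q. (deg E V v - 2) + 2)" by (intro sum_mono) auto
  moreover have "(\<Sum>v\<in>Q. (deg E V v - 2) + 2) = (\<Sum>v\<in>Q. deg E V v - 2) + 2 * card Q"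
    by (simp only: sum.distrib sum_constant) simp
  moreover have "(\<Sum>v\<in>Q. deg E V v - 2) \<le> excess"
    unfolding excess_def using assms finite_V by (intro sum_mono2) auto
  ultimately show ?thesis by linarith
qed

lemma excess_deficiency:
  assumes "ec E V + 1 = card V"
  shows "excess + 2 = (\<Sum>v\<in>V. 2 - deg E V v)"
proof -
  \<comment> \<open>With truncated subtraction both summands are the maximum of the degree and
    2.\<close>
  have "(\<Sum>v\<in>V. (deg E V v - 2) + 2) = (\<Sum>v\<in>V. (2 - deg E V v) + deg E V v)"
    by (intro sum.cong) auto
  then have "excess + 2 * card V = (\<Sum>v\<in>V. 2 - deg E V v) + 2 * ec E V"
    unfolding sum.distrib excess_def by (simp add: sum_deg finite_V)
  then show ?thesis using assms by linarith
qed

end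

section \<open>Invariance of degrees, edge counts and linkedness\<close>

lemma emb_deg:
  assumes "emb f X E E'" "S \<subseteq> X" "v \<in> X"
  shows "deg E' (f ` S) (f v) = deg E S v"
proof -
  have "{u \<in> f ` S. (f v, u) \<in> E'} = f ` {u \<in> S. (v, u) \<in> E}"
    using assms unfolding emb_def by blast
  moreover have "inj_on f {u \<in> S. (v, u) \<in> E}"
    using assms unfolding emb_def by (auto intro: inj_on_subset)
  ultimately show ?thesis by (simp add: deg_def card_image)
qed

lemma emb_ec:
  assumes "emb f S E E'"
  shows "ec E' (f ` S) = ec E S"
proof -
  have "E' \<inter> f ` S \<times> f ` S = map_prod f f ` (E \<inter> S \<times> S)"
    using assms unfolding emb_def by force
  moreover have "inj_on (map_prod f f) (E \<inter> S \<times> S)"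
    using assms unfolding emb_def by (auto intro!: inj_onI dest: inj_onD)
  ultimately show ?thesis by (simp add: ec_def card_image)
qed

lemma emb_linked:
  assumes "emb f S E E'"
  shows "linked E' (f ` S) \<longleftrightarrow> linked E S"
proof -
  have inj: "inj_on f S" using assms by (simp add: emb_def)
  have cut: "(\<exists>x\<in>f ` A. \<exists>y\<in>f ` S - f ` A. (x, y) \<in> E') \<longleftrightarrow> (\<exists>x\<in>A. \<exists>y\<in>S - A. (x, y) \<in> E)"
    if "A \<subseteq> S" for A
  proof -
    have "f ` S - f ` A = f ` (S - A)" using inj_on_image_set_diff[OF inj, of S A] that by simp
    moreover have "(f x, f y) \<in> E' \<longleftrightarrow> (x, y) \<in> E" if "x \<in> A" "y \<in> S - A" for x y
      using that \<open>A \<subseteq> S\<close> assms unfolding emb_def by blast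
    ultimately show ?thesis by simp
  qed
  have psub: "f ` A \<subset> f ` S \<longleftrightarrow> A \<subset> S" if "A \<subseteq> S" for A
    using inj_on_image_eq_iff[OF inj, of A S] that by auto
  show ?thesis
  proof
    assume L: "linked E' (f ` S)"
    show "linked E S"
      unfolding linked_def
    proof (intro conjI allI impI)
      fix A assume A: "A \<subset> S" "A \<noteq> {}"
      then have "f ` A \<subset> f ` S" "f ` A \<noteq> {}" using psub[of A] by auto
      from linkedD[OF L this] show "\<exists>x\<in>A. \<exists>y\<in>S - A. (x, y) \<in> E"
        using A cut[of A] by simp
    qed (use L in \<open>auto simp: linked_def\<close>)
  next
    assume L: "linked E S"
    show "linked E' (f ` S)"
      unfolding linked_def
    proof (intro conjI allI impI)
      fix B assume B: "B \<subset> f ` S" "B \<noteq> {}"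
      then obtain A where A: "A \<subseteq> S" "B = f ` A" by (meson psubset_imp_subset subset_imageE)
      then have "A \<subset> S" "A \<noteq> {}" using psub[of A] B by auto
      from linkedD[OF L this] show "\<exists>x\<in>B. \<exists>y\<in>f ` S - B. (x, y) \<in> E'"
        using A cut[of A] by simp
    qed (use L in \<open>auto simp: linked_def\<close>)
  qed
qed

section \<open>A tree against a disconnected graph\<close>

lemma (in ugraph) forest:
  assumes "linked E V" "ec E V + 1 = card V" "S \<subseteq> V" "S \<noteq> {}"
  shows "ec E S < card S"
  using linked_grow[of V S] assms finite_V by simp

text \<open>With \<open>k = n - l\<close> the bounds are \<open>n \<ge> 2 * l + 1\<close>,
  \<open>l \<ge> 1\<close> and the exclusion of \<open>(5, 2)\<close>.\<close>

locale tree_deck = ugraph_pair +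
  assumes tree: "linked E V" "ec E V + 1 = card V"
    and k_bounds: "card V + 1 \<le> 2 * k" "k < card V" "\<not> (card V = 5 \<and> k = 3)"
begin

text \<open>The degree sum is the count for \<open>t = j = 1\<close>, available because the bounds
  force \<open>2 \<le> k\<close>.\<close>

lemma ec_V': "ec E' V' + 1 = card V'"
proof -
  have "2 \<le> k" using k_bounds by linarith
  then have "(\<Sum>Q\<in>family V 1 (\<lambda>_. True). card (bdry E Q) choose 1)
      = (\<Sum>Q\<in>family V' 1 (\<lambda>_. True). card (bdry E' Q) choose 1)"
    by (intro sum_choose_bdry_eq) (auto simp: invariant_def)
  then have "(\<Sum>v\<in>V. deg E V v) = (\<Sum>v\<in>V'. deg E' V' v)"
    unfolding G.sum_family_singletons[of "\<lambda>x. x choose 1"] G'.sum_family_singletons[of "\<lambda>x. x choose 1"]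
    by simp
  then have "ec E V = ec E' V'"
    using G.sum_deg[OF G.finite_V] G'.sum_deg[OF G'.finite_V] by simp
  then show ?thesis using tree card_V by simp
qed

text \<open>The deck determines how many sets of this size span at least as many edges as vertices;
  in a tree there are none.\<close>

lemma small_forest':
  assumes "S \<subseteq> V'" "S \<noteq> {}" "card S \<le> k"
  shows "ec E' S < card S"
proof (rule ccontr)
  assume cyc: "\<not> ec E' S < card S"
  let ?j = "card S"
  have "?j > 0" using assms G'.finite_sub by (simp add: card_gt_0_iff)
  have "(\<Sum>X | X \<subseteq> V \<and> card X = ?j. if ec E X < ?j then 0 else 1)
      = (\<Sum>X | X \<subseteq> V' \<and> card X = ?j. if ec E' X < ?j then 0 else 1 :: nat)"
    by (rule same_deckD[OF deck_le[OF assms(3)]]) (simp add: emb_ec)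
  moreover have "(\<Sum>X | X \<subseteq> V \<and> card X = ?j. if ec E X < ?j then 0 else 1 :: nat) = 0"
  proof (intro sum.neutral ballI)
    fix X assume "X \<in> {X. X \<subseteq> V \<and> card X = ?j}"
    then have "X \<subseteq> V" "card X = ?j" by auto
    moreover from this have "X \<noteq> {}" using \<open>?j > 0\<close> by auto
    ultimately show "(if ec E X < ?j then 0 else 1 :: nat) = 0"
      using G.forest[OF tree, of X] by simp
  qed
  ultimately have "(\<Sum>X | X \<subseteq> V' \<and> card X = ?j. if ec E' X < ?j then 0 else 1 :: nat) = 0" by simp
  then have "\<forall>X\<in>{X. X \<subseteq> V' \<and> card X = ?j}. (if ec E' X < ?j then 0 else 1 :: nat) = 0"
    using G'.finite_V by (subst (asm) sum_eq_0_iff) auto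
  then show False using cyc assms(1) by auto
qed

text \<open>The left side is 1 at \<open>m = k - 1\<close> and 0 below. At \<open>m = k - 1\<close>
  the right side is \<open>k - 3\<close>, which is where \<open>4 \<le> k\<close> matters.\<close>

lemma choose_pred_le_diff_2:
  assumes "m \<le> k - 1" "4 \<le> k"
  shows "m choose (k - 1) \<le> m - 2"
proof (cases "m = k - 1")
  case False
  then show ?thesis using assms by (simp add: binomial_eq_0)
qed (use assms in auto)

text \<open>The excess of \<open>E'\<close> bounds its degrees by \<open>k - 1\<close> and the number of its vertices of degree
  \<open>k - 1\<close> by less than \<open>k\<close>, whereas a vertex of degree \<open>k\<close> in \<open>E\<close> would produce \<open>k\<close> stars with
  \<open>k\<close> vertices.\<close>

lemma excess_eq:
  assumes "G'.excess + 3 \<le> k" "4 \<le> k"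
  shows "G.excess = G'.excess"
proof -
  have deg': "deg E' V' v \<le> k - 1" if "v \<in> V'" for v
    using G'.deg_le_excess[OF that] assms by linarith
  have "(\<Sum>v\<in>V. deg E V v choose (k - 1)) = (\<Sum>v\<in>V'. deg E' V' v choose (k - 1))"
    unfolding G.sum_family_singletons[of "\<lambda>x. x choose (k - 1)", symmetric]
      G'.sum_family_singletons[of "\<lambda>x. x choose (k - 1)", symmetric]
    using assms by (intro sum_choose_bdry_eq) (auto simp: invariant_def)
  also have "\<dots> \<le> G'.excess"
    unfolding G'.excess_def using deg' assms by (intro sum_mono choose_pred_le_diff_2) auto
  finally have less: "(\<Sum>v\<in>V. deg E V v choose (k - 1)) < k" using assms by linarith
  have deg: "deg E V v \<le> k - 1" if "v \<in> V" for v
  proof (rule ccontr)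
    assume "\<not> deg E V v \<le> k - 1"
    then have "k choose (k - 1) \<le> deg E V v choose (k - 1)" by (intro binomial_right_mono) auto
    also have "\<dots> \<le> (\<Sum>v\<in>V. deg E V v choose (k - 1))"
      using that G.finite_V by (intro member_le_sum) auto
    finally have "k choose (k - 1) < k" using less by linarith
    moreover have "k choose (k - 1) = k" using assms binomial_symmetric[of "k - 1" k] by simp
    ultimately show False by simp
  qed
  let ?g = "\<lambda>x. int (x - 2)"
  have bd: "card (bdry E Q) \<le> k - 1" if Q: "Q \<in> family V 1 (\<lambda>_. True)" for Q
  proof -
    obtain v where "Q = {v}" "v \<in> V" using Q by (auto simp: family_def card_1_singleton_iff)
    moreover have "bdry E {v} = E `` {v}" using G.irrefl_E by (auto simp: bdry_def)
    ultimately show ?thesis using deg G.deg_V by metis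
  qed
  have bd': "card (bdry E' Q) \<le> k - 1" if Q: "Q \<in> family V' 1 (\<lambda>_. True)" for Q
  proof -
    obtain v where "Q = {v}" "v \<in> V'" using Q by (auto simp: family_def card_1_singleton_iff)
    moreover have "bdry E' {v} = E' `` {v}" using G'.irrefl_E by (auto simp: bdry_def)
    ultimately show ?thesis using deg' G'.deg_V by metis
  qed
  \<comment> \<open>With all degrees at most \<open>k - 1\<close> in both graphs, any function of
    the degree has equal sums.\<close>
  have "(\<Sum>Q\<in>family V 1 (\<lambda>_. True). ?g (card (bdry E Q)))
      = (\<Sum>Q\<in>family V' 1 (\<lambda>_. True). ?g (card (bdry E' Q)))"
    using assms bd bd' by (intro sum_bdry_eq[where K = "k - 1"]) (auto simp: invariant_def)
  then have "int G.excess = int G'.excess"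
    unfolding G.sum_family_singletons[of ?g] G'.sum_family_singletons[of ?g] G.excess_def G'.excess_def
    by simp
  then show ?thesis by simp
qed

end

section \<open>Contradiction from a proper tree component\<close>

locale tree_deck_component = tree_deck +
  fixes T
  assumes T: "T \<subseteq> V'" "linked E' T" "ec E' T + 1 = card T" "E' `` T \<subseteq> T" "T \<noteq> V'"
begin

definition M where "M = V' - T"

text \<open>Since \<open>T\<close> is a tree, this fails exactly when \<open>T\<close> is a
  path.\<close>

definition branching :: bool where "branching \<longleftrightarrow> (\<exists>v\<in>T. 3 \<le> deg E' T v)"

text \<open>Instead of isomorphism with \<open>T\<close> it suffices to remember whether \<open>T\<close> is a path.\<close>
definition like_T :: "'s rel \<Rightarrow> 's set \<Rightarrow> bool" where
  "like_T F Q \<longleftrightarrow> linked F Q \<and> ((\<exists>v\<in>Q. 3 \<le> deg F Q v) \<longleftrightarrow> branching)"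

lemma finT: "finite T" using T G'.finite_sub by blast

lemma T_pos: "card T > 0" using T by simp

lemma card_M: "card V = card T + card M"
  using T finT card_V G'.finite_V card_mono[of V' T] by (simp add: M_def card_Diff_subset)

lemma M_nonempty: "M \<noteq> {}" using T by (auto simp: M_def)

lemma ec_M: "ec E' M = card M"
proof -
  have "ec E' V' = ec E' T + ec E' M"
    unfolding M_def using T G'.finite_V by (intro G'.ec_split) auto
  then show ?thesis using ec_V' T card_M card_V by simp
qed

lemma k_less_M: "k < card M"
  using small_forest'[of M] M_nonempty ec_M by (force simp: M_def)

lemma like_T_inv: "invariant E E' (like_T E) (like_T E')"
  unfolding invariant_def
proof (intro allI impI)
  fix f X assume f: "emb f X E E'"
  have "(\<exists>v\<in>f ` X. 3 \<le> deg E' (f ` X) v) \<longleftrightarrow> (\<exists>v\<in>X. 3 \<le> deg E X v)"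
    by (simp add: emb_deg[OF f])
  then show "like_T E X = like_T E' (f ` X)" by (simp add: like_T_def emb_linked[OF f])
qed

lemma T_like_T: "T \<in> family V' (card T) (like_T E')"
  using T by (auto simp: family_def like_T_def branching_def)

lemma bdry_T: "bdry E' T = {}" using T by (auto simp: bdry_def)

lemma bdry_nonempty:
  assumes "Q \<in> family V (card T) (like_T E)"
  shows "bdry E Q \<noteq> {}"
proof -
  have Q: "Q \<subseteq> V" "card Q = card T" "Q \<noteq> {}" using assms by (auto simp: family_def like_T_def linked_def)
  have "card T < card V" using card_M k_less_M by linarith
  then have "Q \<subset> V" using Q by auto
  then show ?thesis using linkedD[OF tree(1) _ Q(3)] by (auto simp: bdry_def)
qed

text \<open>Otherwise the number of sets with empty boundary would agree in both graphs; it is 0 in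
  the tree, whereas \<open>T\<close> is such a set in the other graph.\<close>

lemma large_bdry_exists:
  shows "(\<exists>Q\<in>family V (card T) (like_T E). k - card T < card (bdry E Q))
       \<or> (\<exists>Q\<in>family V' (card T) (like_T E'). k - card T < card (bdry E' Q))"
proof (rule ccontr)
  assume no: "\<not> ?thesis"
  have "card T \<le> k" using card_M k_less_M k_bounds by linarith
  let ?g = "\<lambda>x. if x = 0 then 1 else 0 :: int"
  have "(\<Sum>Q\<in>family V (card T) (like_T E). ?g (card (bdry E Q)))
      = (\<Sum>Q\<in>family V' (card T) (like_T E'). ?g (card (bdry E' Q)))"
    using no \<open>card T \<le> k\<close> T_pos
    by (intro sum_bdry_eq[OF like_T_inv, where K = "k - card T"]) (auto simp: not_less)
  moreover have "(\<Sum>Q\<in>family V (card T) (like_T E). ?g (card (bdry E Q))) = 0"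
    using bdry_nonempty G.finite_bdry by (intro sum.neutral) auto
  moreover have "?g (card (bdry E' T)) \<le> (\<Sum>Q\<in>family V' (card T) (like_T E'). ?g (card (bdry E' Q)))"
    using T_like_T G'.finite_V by (intro member_le_sum) (auto simp: family_def)
  ultimately show False by (simp add: bdry_T)
qed

text \<open>The sum of \<open>card (bdry E Q) choose (k - card T)\<close> agrees in both graphs
  without any bound on boundaries. If it vanishes for \<open>E'\<close>, all boundaries are small in
  both graphs.\<close>

lemma large_bdry_exists':
  shows "\<exists>Q\<in>family V' (card T) (like_T E'). k - card T \<le> card (bdry E' Q)"
proof (rule ccontr)
  assume no: "\<not> ?thesis"
  have "card T \<le> k" using card_M k_less_M k_bounds by linarith
  have "(\<Sum>Q\<in>family V (card T) (like_T E). card (bdry E Q) choose (k - card T))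
      = (\<Sum>Q\<in>family V' (card T) (like_T E'). card (bdry E' Q) choose (k - card T))"
    using \<open>card T \<le> k\<close> T_pos by (intro sum_choose_bdry_eq[OF like_T_inv]) auto
  also have "\<dots> = 0" using no by (intro sum.neutral) (auto simp: not_le)
  finally have "\<forall>Q\<in>family V (card T) (like_T E). card (bdry E Q) choose (k - card T) = 0"
    using G.finite_V by (subst (asm) sum_eq_0_iff) (auto simp: family_def)
  then have "\<forall>Q\<in>family V (card T) (like_T E). card (bdry E Q) < k - card T"
    by (auto simp: binomial_eq_0_iff)
  then show False using large_bdry_exists no by fastforce
qed

lemma no_tree_component: False
proof -
  obtain Q where Q: "Q \<subseteq> V'" "card Q = card T" "like_T E' Q" "k - card T \<le> card (bdry E' Q)"
    using large_bdry_exists' by (auto simp: family_def)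
  then have lQ: "linked E' Q" by (simp add: like_T_def)
  have finQ: "finite Q" using Q G'.finite_sub by blast
  have T_k: "card T + 2 \<le> k" using card_M k_less_M k_bounds by linarith
  \<comment> \<open>Just enough outer neighbours to bring \<open>Q\<close> up to \<open>k\<close>
    vertices.\<close>
  obtain B where B: "B \<subseteq> bdry E' Q" "card B = k - card T"
    using Q(4) by (rule obtain_subset_with_card_n)
  have finB: "finite B" using B G'.finite_bdry finite_subset by blast
  define Y where "Y = Q \<union> B"
  have disj: "Q \<inter> B = {}" using B by (auto simp: bdry_def)
  have cY: "card Y = k" unfolding Y_def using finQ finB disj B Q T_k by (simp add: card_Un_disjoint)
  \<comment> \<open>A linked set meeting the closed set \<open>T\<close> lies in it and, by size,
    equals it; but \<open>T\<close> has no outer neighbours.\<close>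
  have "Q \<inter> T = {}"
  proof (rule ccontr)
    assume "Q \<inter> T \<noteq> {}"
    moreover have "\<not> (\<exists>x\<in>Q \<inter> T. \<exists>y\<in>Q - Q \<inter> T. (x, y) \<in> E')" using T by blast
    ultimately have "\<not> Q \<inter> T \<subset> Q" using linkedD[OF lQ, of "Q \<inter> T"] by blast
    then have "Q \<subseteq> T" by blast
    then have "Q = T" using Q finT by (simp add: card_subset_eq)
    then have "B = {}" using B bdry_T by simp
    then show False using B T_k by simp
  qed
  moreover have "B \<inter> T = {}"
  proof -
    have "E' `` Q \<inter> T = {}" using T(4) G'.sym_E \<open>Q \<inter> T = {}\<close> by blast
    then show ?thesis using B unfolding bdry_def by blast
  qed
  ultimately have YM: "Y \<subseteq> M" using Q B G'.bdry_subset[of Q] by (auto simp: Y_def M_def)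
  obtain C where C: "C \<subseteq> M" "card C = k + 1" "Q \<subseteq> C" "M - C \<subseteq> Y - Q" "k + 1 \<le> ec E' C"
    and tight: "card M + card Q + 1 = 2 * k"
  proof (rule G'.long_cycle_around[of M k Q Y])
    show "M \<subseteq> V'" by (auto simp: M_def)
    then show "ec E' S < card S" if "S \<subseteq> M" "S \<noteq> {}" "card S \<le> k" for S
      using that small_forest' by blast
    show "card M + card Q + 1 \<le> 2 * k" using Q card_M k_bounds by simp
  qed (use ec_M lQ YM cY B in \<open>auto simp: Y_def\<close>)
  have CV: "C \<subseteq> V'" using C by (auto simp: M_def)
  have finM: "finite M" using G'.finite_V by (simp add: M_def)
  have finC: "finite C" using C finM finite_subset by blast
  \<comment> \<open>Tightness means \<open>card V = 2 * k - 1\<close>, so \<open>k = 3\<close> would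
    be the excluded case \<open>card V = 5\<close>.\<close>
  have "k \<ge> 4" using tight T_k Q card_M k_bounds T_pos by (cases "k = 3") auto
  have degC: "deg E' C v = 2" if "v \<in> C" for v
    using that C CV \<open>k \<ge> 4\<close> small_forest' by (intro G'.minimal_cyclic_regular[of C k]) auto
  have "deg E' Q v \<le> 2" if "v \<in> Q" for v
    using that G'.deg_mono[OF C(3) finC, of v] degC C by force
  \<comment> \<open>\<open>Q\<close> lies in the 2-regular set \<open>C\<close>, so it has no
    branching vertex; \<open>like_T\<close> carries this over to \<open>T\<close>.\<close>
  then have "\<not> branching" using Q by (fastforce simp: like_T_def)
  then have degT: "deg E' T v \<le> 2" if "v \<in> T" for v using that by (fastforce simp: branching_def)
  have "deg E' V' v = deg E' T v" if "v \<in> T" for v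
  proof -
    have "{u \<in> V'. (v, u) \<in> E'} = {u \<in> T. (v, u) \<in> E'}" using T that by blast
    then show ?thesis by (simp add: deg_def)
  qed
  then have "(\<Sum>v\<in>T. 2 - deg E' V' v) + (\<Sum>v\<in>T. deg E' T v) = (\<Sum>v\<in>T. 2)"
    using degT by (simp add: sum.distrib[symmetric])
  \<comment> \<open>A tree has degree sum \<open>2 * card T - 2\<close>, so its deficiency below 2
    totals 2 when no degree exceeds 2.\<close>
  then have defT: "(\<Sum>v\<in>T. 2 - deg E' V' v) = 2"
    using G'.sum_deg[OF finT] T by simp
  have "2 \<le> deg E' V' v" if "v \<in> C" for v
    using G'.deg_mono[OF CV G'.finite_V, of v] degC that by simp
  then have defC: "(\<Sum>v\<in>C. 2 - deg E' V' v) = 0" by simp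
  have "2 - deg E' V' v \<le> 1" if "v \<in> M - C" for v
  proof -
    have "v \<in> B" using C that by (auto simp: Y_def)
    then obtain q where "q \<in> Q" "(q, v) \<in> E'" using B by (auto simp: bdry_def)
    then have "0 < deg E' V' v" using G'.sym_E Q G'.finite_V by (intro G'.deg_pos) auto
    then show ?thesis by simp
  qed
  then have "(\<Sum>v\<in>M - C. 2 - deg E' V' v) \<le> card (M - C)"
    using sum_bounded_above[of "M - C" "\<lambda>v. 2 - deg E' V' v" 1] by simp
  moreover have "card (M - C) + k + 1 = card M"
    using C finC finM card_mono[OF finM C(1)] by (simp add: card_Diff_subset)
  moreover have "(\<Sum>v\<in>V'. 2 - deg E' V' v)
      = (\<Sum>v\<in>T. 2 - deg E' V' v) + ((\<Sum>v\<in>C. 2 - deg E' V' v) + (\<Sum>v\<in>M - C. 2 - deg E' V' v))"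
  proof -
    let ?f = "\<lambda>v. 2 - deg E' V' v"
    show ?thesis
      using sum.subset_diff[OF T(1) G'.finite_V, of ?f] sum.subset_diff[OF C(1) finM, of ?f]
      by (simp add: M_def)
  qed
  \<comment> \<open>The deficiency is at most \<open>2 + 0 + card (M - C)\<close>, which is
    \<open>k - card T\<close> by tightness. This bounds \<open>excess + 2\<close>, and hence all
    boundaries once the excess is transferred to the tree.\<close>
  ultimately have exc': "G'.excess + card T + 2 \<le> k"
    using G'.excess_deficiency[OF ec_V'] defT defC tight Q by linarith
  then have "G.excess = G'.excess" using T_pos \<open>k \<ge> 4\<close> by (intro excess_eq) auto
  then have "card (bdry E Q) \<le> k - card T" if "Q \<in> family V (card T) (like_T E)" for Q
    using that G.bdry_le_excess[of Q] exc' by (auto simp: family_def like_T_def)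
  moreover have "card (bdry E' Q) \<le> k - card T" if "Q \<in> family V' (card T) (like_T E')" for Q
    using that G'.bdry_le_excess[of Q] exc' by (auto simp: family_def like_T_def)
  ultimately show False using large_bdry_exists by fastforce
qed

end

lemma (in tree_deck) linked': "linked E' V'"
proof (rule ccontr)
  assume nl: "\<not> linked E' V'"
  have "V' \<noteq> {}" using k_bounds card_V by auto
  moreover have "ec E' V' < card V'" using ec_V' by simp
  ultimately obtain T where T: "T \<subseteq> V'" "linked E' T" "ec E' T + 1 = card T" "E' `` T \<subseteq> T"
    by (rule G'.exists_tree_component)
  then have "T \<noteq> V'" using nl by auto
  with T interpret tree_deck_component V E V' E' k T by unfold_locales
  show False by (rule no_tree_component)
qed

section \<open>Translation to digraphs\<close>

context graph
begin

abbreviation adj :: "'a rel" where "adj \<equiv> arcs_ends G"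

lemma adj_sym: "(x, y) \<in> adj \<Longrightarrow> (y, x) \<in> adj"
  using sym_arcs by (rule arcs_ends_symmetric)

sublocale ugraph "verts G" adj
proof
  show "adj \<subseteq> verts G \<times> verts G" by (auto simp: arcs_ends_conv)
  show "(x, x) \<notin> adj" for x using no_loops by (auto simp: arcs_ends_conv)
qed (auto intro: adj_sym)

lemma graph_induce:
  assumes "S \<subseteq> verts G"
  shows "graph (G \<restriction> S)"
proof -
  have "induced_subgraph (G \<restriction> S) G" using assms by (rule induced_induce)
  then have "digraph (G \<restriction> S)" "symmetric (G \<restriction> S)"
    using digraphI_induced induced_graph_imp_symmetric[OF sym_arcs] by blast+
  then show ?thesis by (rule digraph.graphI)
qed

lemma arcs_ends_induce: "arcs_ends (G \<restriction> S) = adj \<inter> S \<times> S"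
  by (auto simp: arcs_ends_conv)

text \<open>A walk from \<open>A\<close> to a vertex outside must cross the cut; conversely no edge
  leaves the set of vertices reachable from \<open>u\<close>.\<close>

lemma connected_iff_linked: "connected G \<longleftrightarrow> linked adj (verts G)"
proof -
  let ?r = "rtrancl_on (verts G) adj"
  have "adj\<^sup>s = adj" using adj_sym by (auto simp: symcl_def)
  then have conv: "connected G \<longleftrightarrow> verts G \<noteq> {} \<and> (\<forall>u\<in>verts G. \<forall>v\<in>verts G. (u, v) \<in> ?r)"
    by (simp add: connected_conv)
  show ?thesis
  proof
    assume con: "connected G"
    show "linked adj (verts G)"
      unfolding linked_def
    proof (intro conjI allI impI)
      fix A assume A: "A \<subset> verts G" "A \<noteq> {}"
      then obtain a b where ab: "a \<in> A" "b \<in> verts G" "b \<notin> A" by blast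
      then have "(a, b) \<in> ?r" using con A conv by blast
      moreover have "b \<in> A" if "(a, b) \<in> ?r" and no: "\<not> (\<exists>x\<in>A. \<exists>y\<in>verts G - A. (x, y) \<in> adj)"
        using that(1)
      proof (induction rule: rtrancl_on_induct)
        case (step y z)
        then show ?case using no by blast
      qed (use ab in auto)
      ultimately show "\<exists>x\<in>A. \<exists>y\<in>verts G - A. (x, y) \<in> adj" using ab by blast
    qed (use con conv in auto)
  next
    assume link: "linked adj (verts G)"
    have "(u, v) \<in> ?r" if u: "u \<in> verts G" and v: "v \<in> verts G" for u v
    proof (rule ccontr)
      let ?A = "{w \<in> verts G. (u, w) \<in> ?r}"
      assume "(u, v) \<notin> ?r"
      then have "?A \<subset> verts G" "?A \<noteq> {}" using u v by auto
      then obtain x y where "x \<in> ?A" "y \<in> verts G - ?A" "(x, y) \<in> adj"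
        using linkedD[OF link, of ?A] by blast
      then show False using rtrancl_on_into_rtrancl_on[of u x "verts G" adj y] by simp
    qed
    then show "connected G" using link conv by (simp add: linked_def)
  qed
qed

text \<open>All neighbours in \<open>R\<close> of the start of a longest path in \<open>R\<close>
  lie on that path. One of them is not the second vertex, and the arc back from it closes a
  cycle.\<close>

lemma graph_cycle_if_min_degree_2:
  assumes R: "R \<subseteq> verts G" "R \<noteq> {}" and deg: "\<And>v. v \<in> R \<Longrightarrow> 2 \<le> deg adj R v"
  shows "\<exists>p. graph_cycle G p"
proof -
  let ?P = "\<lambda>p. \<exists>u v. apath u p v \<and> set (awalk_verts u p) \<subseteq> R"
  obtain r where "r \<in> R" using R by blast
  then have "?P []" using R by (intro exI[of _ r]) (auto simp: apath_Nil_iff)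
  moreover have "\<forall>p. ?P p \<longrightarrow> length p < Suc (card (verts G))"
    using length_apath le_imp_less_Suc by blast
  ultimately obtain p where "?P p" and longest: "\<And>q. ?P q \<Longrightarrow> length q \<le> length p"
    using ex_has_greatest_nat[of ?P "[]" length "Suc (card (verts G))"] by blast
  then obtain u v where p: "apath u p v" "set (awalk_verts u p) \<subseteq> R" by blast
  then have walk: "awalk u p v" and dist: "distinct (awalk_verts u p)" by (auto simp: apath_def)
  have "u \<in> set (awalk_verts u p)" using walk by (metis awhd_of_awalk awalk_verts_non_Nil hd_in_set)
  then have "u \<in> R" using p by blast
  then have "2 \<le> card {w \<in> R. (u, w) \<in> adj}" using deg by (simp add: deg_def)
  then obtain N where "N \<subseteq> {w \<in> R. (u, w) \<in> adj}" "card N = 2" by (rule obtain_subset_with_card_n)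
  then obtain w w' where w: "w \<noteq> w'" "w \<in> R" "w' \<in> R" "(u, w) \<in> adj" "(u, w') \<in> adj"
    unfolding card_2_iff by blast
  \<comment> \<open>Otherwise the arc from \<open>x\<close> to \<open>u\<close> could be
    prepended.\<close>
  have on_path: "x \<in> set (awalk_verts u p)" if x: "x \<in> R" "(u, x) \<in> adj" for x
  proof (rule ccontr)
    assume notin: "x \<notin> set (awalk_verts u p)"
    obtain a where a: "a \<in> arcs G" "tail G a = x" "head G a = u"
      using adj_sym[OF x(2)] by (auto simp: arcs_ends_conv)
    have "apath x (a # p) v" using a p notin by (simp add: apath_Cons_iff)
    moreover have "set (awalk_verts x (a # p)) \<subseteq> R" using a p x by simp
    ultimately have "length (a # p) \<le> length p" using longest[of "a # p"] by blast
    then show False by simp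
  qed
  have "\<exists>x. x \<in> R \<and> (u, x) \<in> adj \<and> (p = [] \<or> x \<noteq> head G (hd p))"
    using w by (cases "w = head G (hd p)") auto
  then obtain x where x: "x \<in> R" "(u, x) \<in> adj" "p = [] \<or> x \<noteq> head G (hd p)" by blast
  obtain q s where q: "p = q @ s" "awalk u q x" "awalk x s v"
    using awalk_decomp[OF walk on_path[OF x(1,2)]] by blast
  have "q \<noteq> []"
  proof
    assume "q = []"
    then have "x = u" using q by (auto simp: awalk_Nil_iff)
    then show False using x irrefl_E by blast
  qed
  \<comment> \<open>A segment of length one would end in the second vertex of the path; this secures
    three arcs.\<close>
  have "tl q \<noteq> []"
  proof
    assume "tl q = []"
    then have "q = [hd q]" using \<open>q \<noteq> []\<close> by (cases q) auto
    then have "awalk u [hd q] x" using q by simp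
    then have "x = head G (hd q)" by (auto simp: awalk_Cons_iff awalk_Nil_iff)
    then show False using x q \<open>q \<noteq> []\<close> by simp
  qed
  obtain a where a: "a \<in> arcs G" "tail G a = x" "head G a = u"
    using adj_sym[OF x(2)] by (auto simp: arcs_ends_conv)
  then have aw: "awalk u (q @ [a]) u"
    using q walk awalk_hd_in_verts by (auto simp: awalk_simps)
  have vq: "awalk_verts u (q @ [a]) = awalk_verts u q @ [u]"
    using \<open>q \<noteq> []\<close> a q(2) by (auto simp: awalk_verts_conv awalk_def dest: awlast_if_cas)
  have "distinct (awalk_verts u q)"
    using awalk_verts_append[of u q s v] walk dist q(1) by simp
  moreover have "awalk_verts u q = u # tl (awalk_verts u q)"
    using awhd_of_awalk[OF q(2)] by (metis awalk_verts_non_Nil list.collapse)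
  ultimately have "distinct (u # tl (awalk_verts u q))" by metis
  then have "distinct (tl (awalk_verts u (q @ [a])))"
    unfolding vq by (simp add: tl_append2)
  then have "cycle (q @ [a])" unfolding cycle_def using aw by blast
  moreover have "3 \<le> length (q @ [a])" using \<open>q \<noteq> []\<close> \<open>tl q \<noteq> []\<close>
    by (cases q; cases "tl q") auto
  ultimately show ?thesis unfolding graph_cycle_def by blast
qed

text \<open>Some vertex has degree at most 1 in \<open>S\<close>; remove it and use
  induction.\<close>

lemma acyclic_forest:
  assumes "\<not> (\<exists>p. graph_cycle G p)" "S \<subseteq> verts G" "S \<noteq> {}"
  shows "ec adj S < card S"
  using assms(2,3)
proof (induction "card S" arbitrary: S rule: less_induct)
  case less
  have fin: "finite S" using less.prems finite_sub by blast
  obtain v where v: "v \<in> S" "deg adj S v \<le> 1"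
    using graph_cycle_if_min_degree_2[OF less.prems] assms(1) by fastforce
  have del: "ec adj S = ec adj (S - {v}) + deg adj S v"
    using ec_insert[of "S - {v}" v] deg_self[of v "S - {v}"] fin v by (simp add: insert_absorb)
  show ?case
  proof (cases "S - {v} = {}")
    case True
    then have "S = {v}" using v by blast
    then show ?thesis by (simp add: ec_singleton)
  next
    case False
    have "card (S - {v}) < card S" using fin v by (intro psubset_card_mono) auto
    then have "ec adj (S - {v}) < card (S - {v})" using less False by blast
    then show ?thesis using del v fin by simp
  qed
qed

lemma cas_nth:
  "cas u p v \<Longrightarrow> Suc i < length p \<Longrightarrow> tail G (p ! Suc i) = head G (p ! i)"
proof (induction p arbitrary: u i)
  case (Cons e p)
  then show ?case by (cases i; cases p) auto
qed simp

text \<open>Every vertex of the cycle is adjacent to its predecessor and successor, so the handshake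
  lemma applies with degrees at least 2.\<close>

lemma graph_cycle_ec:
  assumes "graph_cycle G p"
  obtains C where "C \<subseteq> verts G" "C \<noteq> {}" "card C \<le> ec adj C"
proof -
  obtain u where u: "awalk u p u" "distinct (tl (awalk_verts u p))" and len: "3 \<le> length p"
    using assms by (auto simp: graph_cycle_def cycle_def)
  let ?m = "length p" and ?x = "\<lambda>i. head G (p ! i)"
  have cas: "cas u p u" and arcs: "set p \<subseteq> arcs G" using u by (auto simp: awalk_def)
  have "p \<noteq> []" using len by auto
  then have "tl (awalk_verts u p) = map (head G) p" using awalk_verts_conv'[OF cas] by simp
  then have dist: "distinct (map (head G) p)" using u by simp
  define C where "C = head G ` set p"
  have fin: "finite C" by (simp add: C_def)
  have inj: "?x i = ?x j \<longleftrightarrow> i = j" if "i < ?m" "j < ?m" for i j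
    using nth_eq_iff_index_eq[OF dist, of i j] that by simp
  have xC: "?x i \<in> C" if "i < ?m" for i using that by (auto simp: C_def)
  have step: "(?x i, ?x (Suc i)) \<in> adj" if "Suc i < ?m" for i
  proof -
    have "p ! Suc i \<in> arcs G" using that arcs by auto
    then show ?thesis using cas_nth[OF cas that] unfolding arcs_ends_conv by (metis (no_types, lifting) image_eqI)
  qed
  have wrap: "(?x (?m - 1), ?x 0) \<in> adj"
  proof -
    have "head G (last p) = u" using cas_ends awlast_if_cas[OF cas] \<open>p \<noteq> []\<close>
      by (simp add: awalk_verts_conv)
    moreover have "tail G (p ! 0) = u" using cas \<open>p \<noteq> []\<close> by (cases p) auto
    ultimately have "tail G (p ! 0) = ?x (?m - 1)" using \<open>p \<noteq> []\<close> by (simp add: last_conv_nth)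
    moreover have "p ! 0 \<in> arcs G" using arcs \<open>p \<noteq> []\<close> by auto
    ultimately show ?thesis unfolding arcs_ends_conv by (metis (no_types, lifting) image_eqI)
  qed
  have "2 \<le> deg adj C c" if c: "c \<in> C" for c
  proof -
    obtain i where i: "i < ?m" "c = ?x i" using c by (auto simp: C_def in_set_conv_nth)
    \<comment> \<open>Cyclic successor and predecessor of \<open>i\<close>; they differ because the
      length is at least 3.\<close>
    define j where "j = (if Suc i = ?m then 0 else Suc i)"
    define h where "h = (if i = 0 then ?m - 1 else i - 1)"
    have jh: "j < ?m" "h < ?m" "j \<noteq> h" using i len by (auto simp: j_def h_def)
    have "(c, ?x j) \<in> adj"
    proof (cases "Suc i = ?m")
      case True
      then have "i = ?m - 1" "j = 0" by (simp_all add: j_def)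
      then show ?thesis using wrap i by simp
    next
      case False
      then show ?thesis using step[of i] i by (simp add: j_def)
    qed
    moreover have "(?x h, c) \<in> adj"
    proof (cases i)
      case 0
      then show ?thesis using wrap i by (simp add: h_def)
    next
      case (Suc i')
      then show ?thesis using step[of i'] i by (simp add: h_def)
    qed
    ultimately have "{?x j, ?x h} \<subseteq> {w \<in> C. (c, w) \<in> adj}" using xC jh adj_sym by blast
    then have "card {?x j, ?x h} \<le> deg adj C c" unfolding deg_def using fin by (intro card_mono) auto
    moreover have "?x j \<noteq> ?x h" using inj jh by blast
    ultimately show ?thesis by simp
  qed
  then have "(\<Sum>c\<in>C. 2) \<le> (\<Sum>c\<in>C. deg adj C c)" by (rule sum_mono)
  then have "card C \<le> ec adj C" using sum_deg[OF fin] by simp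
  moreover have "C \<subseteq> verts G" using arcs by (auto simp: C_def)
  moreover have "C \<noteq> {}" using \<open>p \<noteq> []\<close> by (simp add: C_def)
  ultimately show ?thesis using that by blast
qed

lemma is_tree_iff: "is_tree G \<longleftrightarrow> linked adj (verts G) \<and> ec adj (verts G) + 1 = card (verts G)"
proof
  assume tree: "is_tree G"
  then have link: "linked adj (verts G)" by (simp add: is_tree_def connected_iff_linked)
  moreover have "ec adj (verts G) < card (verts G)"
    using tree acyclic_forest[of "verts G"] link by (auto simp: is_tree_def linked_def)
  ultimately show "linked adj (verts G) \<and> ec adj (verts G) + 1 = card (verts G)"
    using linked_ec[OF link] by simp
next
  assume tree: "linked adj (verts G) \<and> ec adj (verts G) + 1 = card (verts G)"
  have "\<not> graph_cycle G p" for p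
  proof
    assume "graph_cycle G p"
    then obtain C where "C \<subseteq> verts G" "C \<noteq> {}" "card C \<le> ec adj C" by (rule graph_cycle_ec)
    then show False using forest[of C] tree by simp
  qed
  then show "is_tree G" using tree by (simp add: is_tree_def connected_iff_linked)
qed

end

section \<open>From equal decks to equal counts\<close>

lemma iso_class_eq_emb:
  assumes "graph G" "graph G'" "S \<subseteq> verts G" "S' \<subseteq> verts G'"
    and "iso_class (G \<restriction> S) = iso_class (G' \<restriction> S')"
  obtains f where "emb f S (arcs_ends G) (arcs_ends G')" "f ` S = S'"
proof -
  interpret G: graph G by fact
  interpret G': graph G' by fact
  have "digraph_iso (G \<restriction> S) (G' \<restriction> S')"
    using assms iso_class_eq_iff G.graph_induce G'.graph_induce by blast
  then obtain h where h: "pre_digraph.digraph_isomorphism (G \<restriction> S) h" "G' \<restriction> S' = app_iso h (G \<restriction> S)"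
    unfolding digraph_iso_def by blast
  let ?f = "iso_verts h"
  have inj: "inj_on ?f S"
    using pre_digraph.digraph_isomorphism_inj_on_verts[OF h(1)] by simp
  have img: "?f ` S = S'" using arg_cong[OF h(2), of verts] by simp
  have "arcs_ends (app_iso h (G \<restriction> S)) = (\<lambda>(u, v). (?f u, ?f v)) ` arcs_ends (G \<restriction> S)"
    using wf_digraph.arcs_ends_app_iso_eq[OF G.wellformed_induce_subgraph h(1)] .
  then have ends: "arcs_ends G' \<inter> S' \<times> S' = (\<lambda>(u, v). (?f u, ?f v)) ` (arcs_ends G \<inter> S \<times> S)"
    unfolding h(2)[symmetric] G.arcs_ends_induce G'.arcs_ends_induce .
  have "(x, y) \<in> arcs_ends G \<longleftrightarrow> (?f x, ?f y) \<in> arcs_ends G'" if xy: "x \<in> S" "y \<in> S" for x y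
  proof -
    have "(?f x, ?f y) \<in> arcs_ends G' \<longleftrightarrow> (?f x, ?f y) \<in> arcs_ends G' \<inter> S' \<times> S'"
      using xy img by blast
    also have "\<dots> \<longleftrightarrow> (\<exists>u v. (u, v) \<in> arcs_ends G \<inter> S \<times> S \<and> ?f x = ?f u \<and> ?f y = ?f v)"
      unfolding ends by auto
    also have "\<dots> \<longleftrightarrow> (x, y) \<in> arcs_ends G"
      using inj xy by (auto dest: inj_onD)
    finally show ?thesis ..
  qed
  then show ?thesis using that[of ?f] inj img by (simp add: emb_def)
qed

text \<open>Invariance makes both functions factor through one function \<open>F\<close> on
  isomorphism classes, so both sums are the sum of \<open>F\<close> over the common deck.\<close>

lemma deck_same_deck:
  assumes "graph G" "graph G'" "deck k G = deck k G'"
  shows "same_deck k (verts G) (arcs_ends G) (verts G') (arcs_ends G')"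
  unfolding same_deck_def
proof (intro allI impI)
  fix \<phi> :: "'a set \<Rightarrow> nat" and \<phi>'
  assume inv: "\<forall>f X. X \<subseteq> verts G \<longrightarrow> card X = k \<longrightarrow> f ` X \<subseteq> verts G' \<longrightarrow>
    emb f X (arcs_ends G) (arcs_ends G') \<longrightarrow> \<phi> X = \<phi>' (f ` X)"
  interpret G: graph G by fact
  interpret G': graph G' by fact
  let ?K = "{S. S \<subseteq> verts G \<and> card S = k}" and ?K' = "{S. S \<subseteq> verts G' \<and> card S = k}"
  let ?c = "\<lambda>S. iso_class (G \<restriction> S)" and ?c' = "\<lambda>S. iso_class (G' \<restriction> S)"
  have fin: "finite ?K" "finite ?K'" by auto
  have classes: "?c ` ?K = ?c' ` ?K'"
    using arg_cong[OF assms(3), of set_mset] fin by (simp add: deck_def)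
  have eq: "\<phi> S = \<phi>' S'" if K: "S \<in> ?K" "S' \<in> ?K'" "?c S = ?c' S'" for S S'
  proof -
    have S: "S \<subseteq> verts G" "card S = k" "S' \<subseteq> verts G'" using K by auto
    obtain f where "emb f S (arcs_ends G) (arcs_ends G')" "f ` S = S'"
      by (rule iso_class_eq_emb[OF assms(1,2) S(1,3) K(3)])
    then show ?thesis using inv S by blast
  qed
  \<comment> \<open>Equal decks contain the same classes, so every class from \<open>G\<close> has a
    representative in \<open>G'\<close>.\<close>
  define rep where "rep c = (SOME T. T \<in> ?K' \<and> ?c' T = c)" for c
  define F where "F c = \<phi>' (rep c)" for c
  have F: "F (?c S) = \<phi> S" if S: "S \<in> ?K" for S
  proof -
    have "?c S \<in> ?c' ` ?K'" using S classes by blast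
    then obtain T where "?c S = ?c' T" "T \<in> ?K'" by (rule imageE)
    then have "\<exists>T. T \<in> ?K' \<and> ?c' T = ?c S" by (intro exI[of _ T]) simp
    then have "rep (?c S) \<in> ?K' \<and> ?c' (rep (?c S)) = ?c S"
      unfolding rep_def by (rule someI_ex)
    then have "\<phi> S = \<phi>' (rep (?c S))" by (intro eq[OF S]) simp_all
    then show ?thesis by (simp add: F_def)
  qed
  have F': "F (?c' S) = \<phi>' S" if S: "S \<in> ?K'" for S
  proof -
    have "?c' S \<in> ?c ` ?K" using S classes by blast
    then obtain T where "?c' S = ?c T" and T: "T \<in> ?K" by (rule imageE)
    then show ?thesis using F[OF T] eq[OF T S] by simp
  qed
  have "(\<Sum>S\<in>?K. \<phi> S) = (\<Sum>S\<in>?K. F (?c S))" using F by simp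
  also have "\<dots> = sum_mset (image_mset F (deck k G))"
    by (simp add: sum_unfold_sum_mset deck_def image_mset.compositionality comp_def)
  also have "\<dots> = (\<Sum>S\<in>?K'. F (?c' S))"
    unfolding assms(3) by (simp add: sum_unfold_sum_mset deck_def image_mset.compositionality comp_def)
  also have "\<dots> = (\<Sum>S\<in>?K'. \<phi>' S)" using F' by simp
  finally show "(\<Sum>S\<in>?K. \<phi> S) = (\<Sum>S\<in>?K'. \<phi>' S)" .
qed

lemma tree_determined_by_deck:
  assumes "graph G" "graph G'" "card (verts G) = n" "card (verts G') = n"
    and "deck (n - l) G = deck (n - l) G'"
    and l: "l \<ge> 1" "n \<ge> 2 * l + 1" "(n, l) \<noteq> (5, 2)"
    and "is_tree G"
  shows "is_tree G'"
proof -
  interpret G: graph G by fact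
  interpret G': graph G' by fact
  interpret tree_deck "verts G" "arcs_ends G" "verts G'" "arcs_ends G'" "n - l"
  proof
    show "same_deck (n - l) (verts G) (arcs_ends G) (verts G') (arcs_ends G')"
      using assms by (intro deck_same_deck)
    show "linked (arcs_ends G) (verts G)" "ec (arcs_ends G) (verts G) + 1 = card (verts G)"
      using \<open>is_tree G\<close> by (simp_all add: G.is_tree_iff)
  qed (use assms in auto)
  show ?thesis using linked' ec_V' by (simp add: G'.is_tree_iff)
qed

theorem corollary1p3:
  fixes l n :: nat
    and G :: "('a, 'b) pre_digraph"
    and G' :: "('c, 'd) pre_digraph"
  assumes "l \<ge> 1" and "n \<ge> 2 * l + 1" and "(n, l) \<noteq> (5, 2)"
    and "graph G" and "graph G'"
    and "card (verts G) = n" and "card (verts G') = n"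
    and "deck (n - l) G = deck (n - l) G'"
  shows "is_tree G \<longleftrightarrow> is_tree G'"
  using tree_determined_by_deck[of G G' n l] tree_determined_by_deck[of G' G n l] assms by metis

end
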